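(* Let $\varphi:2^\omega\to2^\omega$ be a homeomorphism which is $\mu_p$-preserving for all $p\in(0,1)$ (or merely for infinitely many $p$, or for a single transcendental $p$). Suppose $\varphi$ induces an automorphism $\pi$ of the Turing degrees, i.e. $\pi([X]_{\mathrm T})=[\varphi(X)]_{\mathrm T}$ for all $X\in2^\omega$ defines an automorphism. Then $\pi$ is the identity.
   Context: $\mu_p$ is the Bernoulli product measure on $2^\omega$ (independent bits, each equal to $1$ with probability $p$). $\varphi$ is $\mu_p$-preserving if $\mu_p(\varphi^{-1}(U))=\mu_p(U)$ for all Borel $U$. An automorphism of the Turing degrees is a bijection of the set of Turing degrees preserving and reflecting $\le_{\mathrm T}$. *)

theory Defs
  imports "HOL-Probability.Probability" "HOL-Computational_Algebra.Polynomial"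
begin

section \<open>Bernoulli measures on Cantor space\<close>

type_synonym cantor = "nat \<Rightarrow> bool"

definition bernoulli_measure :: "real \<Rightarrow> cantor measure" where
  "bernoulli_measure p = (\<Pi>\<^sub>M n\<in>UNIV. measure_pmf (bernoulli_pmf p))"

instance bool :: second_countable_topology
proof
  have "open (U :: bool set) \<longleftrightarrow> generate_topology UNIV U" for U
    by (simp add: Topological_Spaces.open_discrete generate_topology.Basis)
  then show "\<exists>B::bool set set. countable B \<and> open = generate_topology B"
    by (intro exI[of _ UNIV]) (auto intro: countable_finite)
qed

lemma sets_bernoulli_measure: "sets (bernoulli_measure p) = sets borel"
proof -
  have "sets (measure_pmf (bernoulli_pmf p)) = sets (borel :: bool measure)"
    by (simp add: sets_borel_eq_count_space)
  then have "sets (bernoulli_measure p) = sets (\<Pi>\<^sub>M n\<in>(UNIV::nat set). (borel :: bool measure))"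
    unfolding bernoulli_measure_def by (intro sets_PiM_cong) auto
  then show ?thesis by (simp add: sets_PiM_equal_borel)
qed

definition bernoulli_preserving :: "real \<Rightarrow> (cantor \<Rightarrow> cantor) \<Rightarrow> bool" where
  "bernoulli_preserving p \<phi> \<longleftrightarrow>
    (\<forall>U\<in>sets borel. emeasure (bernoulli_measure p) (\<phi> -` U) = emeasure (bernoulli_measure p) U)"


section \<open>Turing reducibility\<close>

text \<open>Codes for the partial recursive functions relative to an oracle, in Kleene's sense.
  Arities are not part of the code: a code denotes one partial function for each length of the
  argument list.\<close>

datatype recf =
    Zero
  | Succ
  | Proj nat
  | Oracle
  | Comp recf "recf list"
  | Prec recf recf
  | Mu recf

text \<open>\<^term>\<open>rec_eval A f xs y\<close>: the computation of \<open>f\<close> on arguments \<open>xs\<close> with oracle \<open>A\<close>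
  converges with value \<open>y\<close>.\<close>

inductive rec_eval :: "cantor \<Rightarrow> recf \<Rightarrow> nat list \<Rightarrow> nat \<Rightarrow> bool" for A :: cantor where
  Zero: "rec_eval A Zero xs 0"
| Succ: "rec_eval A Succ [x] (Suc x)"
| Proj: "i < length xs \<Longrightarrow> rec_eval A (Proj i) xs (xs ! i)"
| Oracle: "rec_eval A Oracle [x] (of_bool (A x))"
| Comp: "length ys = length gs \<Longrightarrow> (\<forall>i<length gs. rec_eval A (gs ! i) xs (ys ! i)) \<Longrightarrow>
    rec_eval A f ys z \<Longrightarrow> rec_eval A (Comp f gs) xs z"
| Prec_0: "rec_eval A f xs y \<Longrightarrow> rec_eval A (Prec f g) (0 # xs) y"
| Prec_Suc: "rec_eval A (Prec f g) (n # xs) r \<Longrightarrow> rec_eval A g (n # r # xs) y \<Longrightarrow>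
    rec_eval A (Prec f g) (Suc n # xs) y"
| Mu: "rec_eval A f (n # xs) 0 \<Longrightarrow> (\<forall>m<n. \<exists>k. rec_eval A f (m # xs) (Suc k)) \<Longrightarrow>
    rec_eval A (Mu f) xs n"

inductive_cases rec_eval_ZeroE: "rec_eval A Zero xs y"
inductive_cases rec_eval_SuccE: "rec_eval A Succ xs y"
inductive_cases rec_eval_ProjE: "rec_eval A (Proj i) xs y"
inductive_cases rec_eval_OracleE: "rec_eval A Oracle xs y"
inductive_cases rec_eval_CompE: "rec_eval A (Comp f gs) xs y"
inductive_cases rec_eval_Prec_0E: "rec_eval A (Prec f g) (0 # xs) y"
inductive_cases rec_eval_Prec_SucE: "rec_eval A (Prec f g) (Suc n # xs) y"
inductive_cases rec_eval_MuE: "rec_eval A (Mu f) xs y"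

lemma rec_eval_deterministic:
  "rec_eval A f xs y \<Longrightarrow> rec_eval A f xs z \<Longrightarrow> y = z"
proof (induction arbitrary: z rule: rec_eval.induct)
  case (Comp ys gs xs f v)
  from Comp.prems obtain ys' where ys': "length ys' = length gs"
      "\<forall>i<length gs. rec_eval A (gs ! i) xs (ys' ! i)" "rec_eval A f ys' z"
    by (rule rec_eval_CompE) blast
  then have "ys = ys'"
    using Comp.hyps Comp.IH by (intro nth_equalityI) auto
  then show ?case using Comp.IH ys' by blast
next
  case (Mu f n xs)
  from Mu.prems have z: "rec_eval A f (z # xs) 0" "\<forall>m<z. \<exists>k. rec_eval A f (m # xs) (Suc k)"
    by (auto elim: rec_eval_MuE)
  have "\<not> z < n"
  proof
    assume "z < n"
    then obtain k where "\<forall>v. rec_eval A f (z # xs) v \<longrightarrow> Suc k = v"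
      using Mu.IH(2) by meson
    then show False using z(1) by blast
  qed
  moreover have "\<not> n < z"
  proof
    assume "n < z"
    then obtain k where "rec_eval A f (n # xs) (Suc k)"
      using z(2) by meson
    then show False using Mu.IH(1)[of "Suc k"] by simp
  qed
  ultimately show ?case by simp
next
  case (Prec_Suc f g n xs r y)
  from Prec_Suc.prems obtain r' where "rec_eval A (Prec f g) (n # xs) r'"
      "rec_eval A g (n # r' # xs) z"
    by (rule rec_eval_Prec_SucE) blast
  then show ?case using Prec_Suc.IH by blast
next
  case (Zero xs)
  then show ?case by (rule rec_eval_ZeroE) simp
next
  case (Succ x)
  then show ?case by (rule rec_eval_SuccE) simp
next
  case (Proj i xs)
  from Proj.prems show ?case by (rule rec_eval_ProjE) simp
next
  case (Oracle x)
  then show ?case by (rule rec_eval_OracleE) simp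
next
  case (Prec_0 f xs y g)
  from Prec_0.prems have "rec_eval A f xs z" by (rule rec_eval_Prec_0E)
  then show ?case by (rule Prec_0.IH)
qed

definition turing_reducible :: "cantor \<Rightarrow> cantor \<Rightarrow> bool"  (infix "\<le>\<^sub>T" 50) where
  "X \<le>\<^sub>T Y \<longleftrightarrow> (\<exists>f. \<forall>n. rec_eval Y f [n] (of_bool (X n)))"

definition turing_equiv :: "cantor \<Rightarrow> cantor \<Rightarrow> bool"  (infix "\<equiv>\<^sub>T" 50) where
  "X \<equiv>\<^sub>T Y \<longleftrightarrow> X \<le>\<^sub>T Y \<and> Y \<le>\<^sub>T X"

lemma turing_reducible_refl: "X \<le>\<^sub>T X"
  unfolding turing_reducible_def by (blast intro: rec_eval.Oracle)

primrec subst_oracle :: "recf \<Rightarrow> recf \<Rightarrow> recf" where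
  "subst_oracle h Zero = Zero"
| "subst_oracle h Succ = Succ"
| "subst_oracle h (Proj i) = Proj i"
| "subst_oracle h Oracle = h"
| "subst_oracle h (Comp f gs) = Comp (subst_oracle h f) (map (subst_oracle h) gs)"
| "subst_oracle h (Prec f g) = Prec (subst_oracle h f) (subst_oracle h g)"
| "subst_oracle h (Mu f) = Mu (subst_oracle h f)"

lemma rec_eval_subst_oracle:
  assumes "rec_eval Y f xs y" and h: "\<And>n. rec_eval Z h [n] (of_bool (Y n))"
  shows "rec_eval Z (subst_oracle h f) xs y"
  using assms(1)
proof (induction rule: rec_eval.induct)
  case (Oracle x)
  then show ?case using h by simp
next
  case (Comp ys gs xs f z)
  then show ?case by (auto intro!: rec_eval.Comp[where ys = ys])
next
  case (Mu f n xs)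
  then show ?case by (auto intro!: rec_eval.Mu)
next
  case (Prec_Suc f g n xs r y)
  then show ?case by (auto intro: rec_eval.Prec_Suc)
qed (auto intro: rec_eval.Zero rec_eval.Succ rec_eval.Proj rec_eval.Prec_0)

lemma turing_reducible_trans:
  assumes "X \<le>\<^sub>T Y" "Y \<le>\<^sub>T Z" shows "X \<le>\<^sub>T Z"
proof -
  obtain f h where "\<And>n. rec_eval Y f [n] (of_bool (X n))" "\<And>n. rec_eval Z h [n] (of_bool (Y n))"
    using assms unfolding turing_reducible_def by blast
  then have "rec_eval Z (subst_oracle h f) [n] (of_bool (X n))" for n
    by (rule rec_eval_subst_oracle)
  then show ?thesis
    unfolding turing_reducible_def by blast
qed


section \<open>Turing degrees\<close>

quotient_type turing_degree = cantor / turing_equiv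
  morphisms rep_turing_degree turing_deg
proof (rule equivpI)
  show "reflp turing_equiv"
    by (simp add: reflp_def turing_equiv_def turing_reducible_refl)
  show "symp turing_equiv"
    by (simp add: symp_def turing_equiv_def)
  show "transp turing_equiv"
    unfolding transp_def turing_equiv_def by (meson turing_reducible_trans)
qed

instantiation turing_degree :: order
begin

lift_definition less_eq_turing_degree :: "turing_degree \<Rightarrow> turing_degree \<Rightarrow> bool"
  is turing_reducible
  unfolding turing_equiv_def by (meson turing_reducible_trans)

definition less_turing_degree :: "turing_degree \<Rightarrow> turing_degree \<Rightarrow> bool" where
  "less_turing_degree a b \<longleftrightarrow> a \<le> b \<and> \<not> b \<le> a"

instance
proof
  fix a b c :: turing_degree
  show "a < b \<longleftrightarrow> a \<le> b \<and> \<not> b \<le> a" by (rule less_turing_degree_def)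
  show "a \<le> a" by transfer (rule turing_reducible_refl)
  show "a \<le> c" if "a \<le> b" "b \<le> c" using that by transfer (rule turing_reducible_trans)
  show "a = b" if "a \<le> b" "b \<le> a" using that by transfer (simp add: turing_equiv_def)
qed

end

lemma turing_deg_eq_iff: "turing_deg X = turing_deg Y \<longleftrightarrow> X \<equiv>\<^sub>T Y"
  by (rule turing_degree.abs_eq_iff)

lemma turing_deg_le_iff: "turing_deg X \<le> turing_deg Y \<longleftrightarrow> X \<le>\<^sub>T Y"
  by (rule less_eq_turing_degree.abs_eq)

definition turing_degree_automorphism :: "(turing_degree \<Rightarrow> turing_degree) \<Rightarrow> bool" where
  "turing_degree_automorphism \<pi> \<longleftrightarrow> bij \<pi> \<and> (\<forall>a b. \<pi> a \<le> \<pi> b \<longleftrightarrow> a \<le> b)"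

end

theory Submission
  imports Defs
begin

text \<open>Given \<open>Z\<close>, let \<open>p\<close> be the real in \<open>[1/3, 2/3]\<close> whose base-4 digits are \<open>1 + Z n\<close>. The law of large
  numbers with an explicit rate lets a set of \<open>X\<close> of positive \<open>\<mu>\<^sub>p\<close>-measure compute \<open>Z\<close>. Applying
  \<open>\<phi>\<close>, which preserves \<open>\<mu>\<^sub>p\<close> and Turing reducibility, a set of positive \<open>\<mu>\<^sub>p\<close>-measure computes \<open>\<phi> Z\<close>. But \<open>\<mu>\<^sub>p\<close> is
  computable from \<open>Z\<close>, so by density and a majority vote whatever a set of positive \<open>\<mu>\<^sub>p\<close>-measure
  computes is already computable from \<open>Z\<close>. Hence \<open>\<phi> Z \<le>\<^sub>T Z\<close>, and likewise for the inverse of \<open>\<phi>\<close>.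
  Preservation of \<open>\<mu>\<^sub>p\<close> for all \<open>p\<close> follows from the weaker hypotheses because the measure of a clopen
  set is a polynomial in \<open>p\<close> with integer coefficients.\<close>

section \<open>Computability relative to an oracle\<close>

text \<open>A continuous \<open>\<phi>\<close> gives \<open>\<phi> Z\<close> from \<open>Z\<close>
  together with a code for \<open>\<phi>\<close>, and that code may be an arbitrary oracle. Measure
  removes it: \<open>\<phi>\<close> enters only through preservation of a measure and of
  reducibility, and the set carried over by \<open>\<phi>\<close> need not be effective, since only
  its measure is used. The measure must itself encode \<open>Z\<close>: by the majority vote, sets
  of positive measure for a bias compute nothing beyond the sequence coded by that bias. So each
  \<open>Z\<close> requires its own bias, and preservation has to hold for all of them. Density
  takes the form of clopen approximation. The oracles on which one program computes the target form
  a G_delta set, and a clopen set that nearly equals it serves as the electorate. It is finite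
  information, hence can be built into the program even though it is not found effectively. Real
  inequalities between measures are not decidable, so votes are counted with integer lower bounds of
  the cylinder weights, against a rational threshold placed in a gap between the possible wrong
  votes and the eventual right votes.\<close>

definition computable_in :: "cantor \<Rightarrow> nat \<Rightarrow> (nat list \<Rightarrow> nat) \<Rightarrow> bool" where
  "computable_in A k F \<longleftrightarrow> (\<exists>f. \<forall>xs. length xs = k \<longrightarrow> rec_eval A f xs (F xs))"

abbreviation decidable_in :: "cantor \<Rightarrow> nat \<Rightarrow> (nat list \<Rightarrow> bool) \<Rightarrow> bool" where
  "decidable_in A k P \<equiv> computable_in A k (\<lambda>xs. of_bool (P xs))"

lemma computable_in_cong:
  assumes "computable_in A k F" "\<And>xs. length xs = k \<Longrightarrow> F xs = G xs"
  shows "computable_in A k G"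
  using assms unfolding computable_in_def by metis

lemma computable_in_nth: "i < k \<Longrightarrow> computable_in A k (\<lambda>xs. xs ! i)"
  unfolding computable_in_def by (rule exI[of _ "Proj i"]) (simp add: rec_eval.Proj)

lemma computable_in_compose:
  assumes F: "computable_in A m F" and m: "length Gs = m"
    and Gs: "\<And>G. G \<in> set Gs \<Longrightarrow> computable_in A k G"
  shows "computable_in A k (\<lambda>xs. F (map (\<lambda>G. G xs) Gs))"
proof -
  obtain f where f: "\<And>ys. length ys = m \<Longrightarrow> rec_eval A f ys (F ys)"
    using F unfolding computable_in_def by blast
  obtain g where g: "\<And>G xs. G \<in> set Gs \<Longrightarrow> length xs = k \<Longrightarrow> rec_eval A (g G) xs (G xs)"
    using Gs unfolding computable_in_def by metis
  have "rec_eval A (Comp f (map g Gs)) xs (F (map (\<lambda>G. G xs) Gs))" if "length xs = k" for xs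
    by (rule rec_eval.Comp[where ys = "map (\<lambda>G. G xs) Gs"]) (use that g f m in auto)
  then show ?thesis unfolding computable_in_def by blast
qed

lemma computable_in_compose1:
  assumes "computable_in A 1 (\<lambda>xs. h (xs ! 0))" "computable_in A k F"
  shows "computable_in A k (\<lambda>xs. h (F xs))"
  using computable_in_compose[OF assms(1), of "[F]" k] assms(2) by simp

text \<open>Expresses \<open>drop j\<close> as a tuple of projections, so that bound variables in
  front of the parameters can be discarded by composition.\<close>

lemma map_nth_shift:
  "length ys = k + j \<Longrightarrow> map (\<lambda>G. G ys) (map (\<lambda>i ys. ys ! (i + j)) [0..<k]) = drop j ys"
  by (rule nth_equalityI) (auto simp: add.commute)

lemma computable_in_drop:
  assumes "computable_in A k F"
  shows "computable_in A (k + j) (\<lambda>ys. F (drop j ys))"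
proof -
  have "computable_in A (k + j) (\<lambda>ys. F (map (\<lambda>G. G ys) (map (\<lambda>i ys. ys ! (i + j)) [0..<k])))"
    by (rule computable_in_compose[OF assms]) (auto intro: computable_in_nth)
  then show ?thesis by (rule computable_in_cong) (simp only: map_nth_shift)
qed

text \<open>In a recursion accumulating a sum or a product, the step receives counter, accumulator
  and parameters, while the summand or factor must not see the accumulator.\<close>

lemma computable_in_drop_second:
  assumes "computable_in A (Suc k) F"
  shows "computable_in A (Suc (Suc k)) (\<lambda>ys. F (ys ! 0 # drop 2 ys))"
proof -
  have "computable_in A (Suc (Suc k))
    (\<lambda>ys. F (map (\<lambda>G. G ys) ((\<lambda>ys. ys ! 0) # map (\<lambda>i ys. ys ! (i + 2)) [0..<k])))"
    by (rule computable_in_compose[OF assms]) (auto intro: computable_in_nth)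
  then show ?thesis
    by (rule computable_in_cong) (simp only: list.map(2), subst map_nth_shift, simp_all)
qed

lemma computable_in_Suc:
  assumes "computable_in A k F"
  shows "computable_in A k (\<lambda>xs. Suc (F xs))"
proof (rule computable_in_compose1[OF _ assms])
  show "computable_in A 1 (\<lambda>xs. Suc (xs ! 0))"
    unfolding computable_in_def
    by (rule exI[of _ Succ]) (auto simp: length_Suc_conv intro: rec_eval.Succ)
qed

lemma computable_in_const: "computable_in A k (\<lambda>xs. c)"
proof (induction c)
  case 0
  then show ?case
    unfolding computable_in_def by (rule exI[of _ Zero]) (simp add: rec_eval.Zero)
next
  case (Suc c)
  then show ?case by (rule computable_in_Suc)
qed

lemma decidable_in_oracle:
  assumes "computable_in A k F"
  shows "decidable_in A k (\<lambda>xs. A (F xs))"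
proof (rule computable_in_compose1[where h = "\<lambda>n. of_bool (A n)", OF _ assms])
  show "decidable_in A 1 (\<lambda>xs. A (xs ! 0))"
    unfolding computable_in_def
    by (rule exI[of _ Oracle]) (auto simp: length_Suc_conv split del: split_of_bool intro: rec_eval.Oracle)
qed

lemma computable_in_rec_nat:
  assumes N: "computable_in A k N" and F: "computable_in A k F"
    and G: "computable_in A (Suc (Suc k)) G"
  shows "computable_in A k (\<lambda>xs. rec_nat (F xs) (\<lambda>n r. G (n # r # xs)) (N xs))"
proof -
  obtain f g where f: "\<And>ys. length ys = k \<Longrightarrow> rec_eval A f ys (F ys)"
    and g: "\<And>ys. length ys = Suc (Suc k) \<Longrightarrow> rec_eval A g ys (G ys)"
    using F G unfolding computable_in_def by blast
  define R where "R = (\<lambda>ys. rec_nat (F (tl ys)) (\<lambda>n r. G (n # r # tl ys)) (hd ys))"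
  have "rec_eval A (Prec f g) (n # xs) (R (n # xs))" if "length xs = k" for n xs
  proof (induction n)
    case 0
    then show ?case using f that by (simp add: R_def rec_eval.Prec_0)
  next
    case (Suc n)
    have "rec_eval A g (n # R (n # xs) # xs) (R (Suc n # xs))"
      using g[of "n # R (n # xs) # xs"] that by (simp add: R_def)
    with Suc show ?case by (rule rec_eval.Prec_Suc)
  qed
  then have "computable_in A (Suc k) R"
    unfolding computable_in_def by (intro exI[of _ "Prec f g"]) (auto simp: length_Suc_conv)
  then have "computable_in A k
    (\<lambda>xs. R (map (\<lambda>G. G xs) (N # map (\<lambda>i ys. ys ! (i + 0)) [0..<k])))"
    by (rule computable_in_compose) (auto intro: computable_in_nth N)
  then show ?thesis
    by (rule computable_in_cong) (simp only: list.map(2), subst map_nth_shift, simp_all add: R_def)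
qed

lemma computable_in_Least:
  assumes F: "computable_in A (Suc k) F" and ex: "\<And>xs. length xs = k \<Longrightarrow> \<exists>n. F (n # xs) = 0"
  shows "computable_in A k (\<lambda>xs. LEAST n. F (n # xs) = 0)"
proof -
  obtain f where f: "\<And>ys. length ys = Suc k \<Longrightarrow> rec_eval A f ys (F ys)"
    using F unfolding computable_in_def by blast
  have "rec_eval A (Mu f) xs (LEAST n. F (n # xs) = 0)" if xs: "length xs = k" for xs
  proof (rule rec_eval.Mu)
    have "F ((LEAST n. F (n # xs) = 0) # xs) = 0"
      using ex[OF xs] by (rule LeastI_ex)
    then show "rec_eval A f ((LEAST n. F (n # xs) = 0) # xs) 0"
      using f[of "(LEAST n. F (n # xs) = 0) # xs"] xs by simp
    show "\<forall>m<LEAST n. F (n # xs) = 0. \<exists>j. rec_eval A f (m # xs) (Suc j)"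
    proof (intro allI impI)
      fix m assume "m < (LEAST n. F (n # xs) = 0)"
      then have "F (m # xs) \<noteq> 0" by (rule not_less_Least)
      then obtain j where "F (m # xs) = Suc j" using not0_implies_Suc by blast
      then show "\<exists>j. rec_eval A f (m # xs) (Suc j)"
        using f[of "m # xs"] xs by (intro exI[of _ j]) simp
    qed
  qed
  then show ?thesis unfolding computable_in_def by blast
qed

section \<open>Arithmetic by primitive recursion\<close>

lemma computable_in_add:
  assumes "computable_in A k F" "computable_in A k G"
  shows "computable_in A k (\<lambda>xs. F xs + G xs)"
proof -
  have "computable_in A (Suc (Suc k)) (\<lambda>ys. Suc (ys ! 1))"
    by (intro computable_in_Suc computable_in_nth) simp
  from computable_in_rec_nat[OF assms(2,1) this] show ?thesis
  proof (rule computable_in_cong)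
    fix xs
    have "rec_nat a (\<lambda>n r. Suc ((n # r # xs) ! 1)) b = a + b" for a b by (induction b) auto
    then show "rec_nat (F xs) (\<lambda>n r. Suc ((n # r # xs) ! 1)) (G xs) = F xs + G xs" by blast
  qed
qed

lemma computable_in_sum:
  assumes G: "computable_in A (Suc k) G" and N: "computable_in A k N"
  shows "computable_in A k (\<lambda>xs. \<Sum>i<N xs. G (i # xs))"
proof -
  have "computable_in A (Suc (Suc k)) (\<lambda>ys. ys ! 1 + G (ys ! 0 # drop 2 ys))"
    by (intro computable_in_add computable_in_drop_second G computable_in_nth) simp
  from computable_in_rec_nat[OF N computable_in_const[of _ _ 0] this] show ?thesis
  proof (rule computable_in_cong)
    fix xs
    have "rec_nat 0 (\<lambda>n r. (n # r # xs) ! 1 + G ((n # r # xs) ! 0 # drop 2 (n # r # xs))) b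
      = (\<Sum>i<b. G (i # xs))" for b
      by (induction b) auto
    then show "rec_nat 0 (\<lambda>n r. (n # r # xs) ! 1 + G ((n # r # xs) ! 0 # drop 2 (n # r # xs))) (N xs)
      = (\<Sum>i<N xs. G (i # xs))" by blast
  qed
qed

lemma computable_in_mult:
  assumes "computable_in A k F" "computable_in A k G"
  shows "computable_in A k (\<lambda>xs. F xs * G xs)"
proof -
  have "computable_in A k (\<lambda>xs. \<Sum>i<G xs. F (drop 1 (i # xs)))"
    using computable_in_drop[OF assms(1), of 1] by (intro computable_in_sum assms(2)) simp
  then show ?thesis by (rule computable_in_cong) simp
qed

lemma computable_in_prod:
  assumes G: "computable_in A (Suc k) G" and N: "computable_in A k N"
  shows "computable_in A k (\<lambda>xs. \<Prod>i<N xs. G (i # xs))"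
proof -
  have "computable_in A (Suc (Suc k)) (\<lambda>ys. ys ! 1 * G (ys ! 0 # drop 2 ys))"
    by (intro computable_in_mult computable_in_drop_second G computable_in_nth) simp
  from computable_in_rec_nat[OF N computable_in_const[of _ _ 1] this] show ?thesis
  proof (rule computable_in_cong)
    fix xs
    have "rec_nat 1 (\<lambda>n r. (n # r # xs) ! 1 * G ((n # r # xs) ! 0 # drop 2 (n # r # xs))) b
      = (\<Prod>i<b. G (i # xs))" for b
      by (induction b) auto
    then show "rec_nat 1 (\<lambda>n r. (n # r # xs) ! 1 * G ((n # r # xs) ! 0 # drop 2 (n # r # xs))) (N xs)
      = (\<Prod>i<N xs. G (i # xs))" by blast
  qed
qed

lemma computable_in_power:
  assumes "computable_in A k F" "computable_in A k G"
  shows "computable_in A k (\<lambda>xs. F xs ^ G xs)"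
proof -
  have "computable_in A k (\<lambda>xs. \<Prod>i<G xs. F (drop 1 (i # xs)))"
    using computable_in_drop[OF assms(1), of 1] by (intro computable_in_prod assms(2)) simp
  then show ?thesis by (rule computable_in_cong) simp
qed

lemma computable_in_diff:
  assumes "computable_in A k F" "computable_in A k G"
  shows "computable_in A k (\<lambda>xs. F xs - G xs)"
proof -
  have pred: "computable_in A m (\<lambda>xs. H xs - 1)" if H: "computable_in A m H" for m H
  proof -
    have "computable_in A m (\<lambda>xs. rec_nat 0 (\<lambda>n r. (n # r # xs) ! 0) (H xs))"
      by (intro computable_in_rec_nat H computable_in_const computable_in_nth) simp
    then show ?thesis
    proof (rule computable_in_cong)
      fix xs
      have "rec_nat 0 (\<lambda>n r. (n # r # xs) ! 0) b = b - 1" for b by (induction b) auto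
      then show "rec_nat 0 (\<lambda>n r. (n # r # xs) ! 0) (H xs) = H xs - 1" by blast
    qed
  qed
  have "computable_in A k (\<lambda>xs. rec_nat (F xs) (\<lambda>n r. (n # r # xs) ! 1 - 1) (G xs))"
    by (intro computable_in_rec_nat assms pred computable_in_nth) simp
  then show ?thesis
  proof (rule computable_in_cong)
    fix xs
    have "rec_nat a (\<lambda>n r. (n # r # xs) ! 1 - 1) b = a - b" for a b by (induction b) auto
    then show "rec_nat (F xs) (\<lambda>n r. (n # r # xs) ! 1 - 1) (G xs) = F xs - G xs" by blast
  qed
qed

section \<open>Decidable predicates, case distinction and binary digits\<close>

lemma decidable_in_less:
  assumes "computable_in A k F" "computable_in A k G"
  shows "decidable_in A k (\<lambda>xs. F xs < G xs)"
proof -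
  have "computable_in A k (\<lambda>xs. 1 - (1 - (G xs - F xs)))"
    by (intro computable_in_diff computable_in_const assms)
  then show ?thesis by (rule computable_in_cong) auto
qed

lemma decidable_in_not:
  assumes "decidable_in A k P"
  shows "decidable_in A k (\<lambda>xs. \<not> P xs)"
proof -
  have "computable_in A k (\<lambda>xs. 1 - of_bool (P xs))"
    by (intro computable_in_diff computable_in_const assms)
  then show ?thesis by (rule computable_in_cong) auto
qed

lemma decidable_in_conj:
  assumes "decidable_in A k P" "decidable_in A k Q"
  shows "decidable_in A k (\<lambda>xs. P xs \<and> Q xs)"
  using computable_in_mult[OF assms] by (rule computable_in_cong) auto

lemma decidable_in_disj:
  assumes "decidable_in A k P" "decidable_in A k Q"
  shows "decidable_in A k (\<lambda>xs. P xs \<or> Q xs)"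
  using decidable_in_not[OF decidable_in_conj[OF assms[THEN decidable_in_not]]] by simp

lemma decidable_in_eq:
  assumes "computable_in A k F" "computable_in A k G"
  shows "decidable_in A k (\<lambda>xs. F xs = G xs)"
proof -
  have "decidable_in A k (\<lambda>xs. \<not> F xs < G xs \<and> \<not> G xs < F xs)"
    by (intro decidable_in_conj decidable_in_not decidable_in_less assms)
  then show ?thesis by (rule computable_in_cong) auto
qed

lemma decidable_in_all_less:
  assumes P: "decidable_in A (Suc k) P" and N: "computable_in A k N"
  shows "decidable_in A k (\<lambda>xs. \<forall>i<N xs. P (i # xs))"
proof -
  have "(\<Prod>i<n. of_bool (P (i # xs)) :: nat) = of_bool (\<forall>i<n. P (i # xs))" for n xs
    by (induction n) (auto simp: less_Suc_eq)
  with computable_in_prod[OF P N] show ?thesis by simp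
qed

lemma decidable_in_ball_set:
  assumes "\<And>G. G \<in> set Gs \<Longrightarrow> decidable_in A k G"
  shows "decidable_in A k (\<lambda>xs. \<forall>G\<in>set Gs. G xs)"
  using assms
proof (induction Gs)
  case Nil
  then show ?case using computable_in_const[of A k 1] by simp
next
  case (Cons G Gs)
  then have "decidable_in A k (\<lambda>xs. G xs \<and> (\<forall>G\<in>set Gs. G xs))"
    by (intro decidable_in_conj) auto
  then show ?case by simp
qed

lemma decidable_in_finite:
  assumes "finite S" "computable_in A k F"
  shows "decidable_in A k (\<lambda>xs. F xs \<in> S)"
  using assms(1)
proof (induction rule: finite_induct)
  case empty
  then show ?case using computable_in_const[of A k 0] by simp
next
  case (insert x S)
  have "decidable_in A k (\<lambda>xs. F xs = x \<or> F xs \<in> S)"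
    by (intro decidable_in_disj decidable_in_eq assms(2) computable_in_const insert.IH)
  then show ?case by simp
qed

lemma computable_in_if:
  assumes "decidable_in A k P" "computable_in A k F" "computable_in A k G"
  shows "computable_in A k (\<lambda>xs. if P xs then F xs else G xs)"
proof -
  have "computable_in A k (\<lambda>xs. of_bool (P xs) * F xs + of_bool (\<not> P xs) * G xs)"
    by (intro computable_in_add computable_in_mult decidable_in_not assms)
  then show ?thesis by (rule computable_in_cong) auto
qed

lemma decidable_in_odd:
  assumes "computable_in A k F"
  shows "decidable_in A k (\<lambda>xs. odd (F xs))"
proof -
  have "computable_in A k (\<lambda>xs. rec_nat 0 (\<lambda>n r. 1 - (n # r # xs) ! 1) (F xs))"
    by (intro computable_in_rec_nat computable_in_diff computable_in_const computable_in_nth assms) simp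
  then show ?thesis
  proof (rule computable_in_cong)
    fix xs
    have "rec_nat 0 (\<lambda>n r. 1 - (n # r # xs) ! 1) b = of_bool (odd b)" for b by (induction b) auto
    then show "rec_nat 0 (\<lambda>n r. 1 - (n # r # xs) ! 1) (F xs) = of_bool (odd (F xs))" by blast
  qed
qed

lemma computable_in_div_power2:
  assumes "computable_in A k F" "computable_in A k G"
  shows "computable_in A k (\<lambda>xs. F xs div 2 ^ G xs)"
proof -
  have half: "computable_in A m (\<lambda>xs. H xs div 2)" if H: "computable_in A m H" for m H
  proof -
    \<comment> \<open>\<open>b div 2\<close> is the number of odd numbers below
      \<open>b\<close>.\<close>
    have "computable_in A m (\<lambda>xs. \<Sum>i<H xs. of_bool (odd ((i # xs) ! 0)))"
      by (intro computable_in_sum H decidable_in_odd computable_in_nth) simp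
    then show ?thesis
    proof (rule computable_in_cong)
      fix xs :: "nat list"
      have "(\<Sum>i<n. of_bool (odd ((i # xs) ! 0))) = n div 2" for n :: nat by (induction n) auto
      then show "(\<Sum>i<H xs. of_bool (odd ((i # xs) ! 0))) = H xs div 2" by blast
    qed
  qed
  have "computable_in A k (\<lambda>xs. rec_nat (F xs) (\<lambda>n r. (n # r # xs) ! 1 div 2) (G xs))"
    by (intro computable_in_rec_nat assms half computable_in_nth) simp
  then show ?thesis
  proof (rule computable_in_cong)
    fix xs
    have "rec_nat a (\<lambda>n r. (n # r # xs) ! 1 div 2) b = a div 2 ^ b" for a b
      by (induction b) (auto simp: div_mult2_eq[symmetric] mult.commute)
    then show "rec_nat (F xs) (\<lambda>n r. (n # r # xs) ! 1 div 2) (G xs) = F xs div 2 ^ G xs" by blast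
  qed
qed

lemma decidable_in_bit:
  assumes "computable_in A k F" "computable_in A k G"
  shows "decidable_in A k (\<lambda>xs. bit (F xs) (G xs))"
  unfolding bit_iff_odd by (intro decidable_in_odd computable_in_div_power2 assms)

lemmas computable_in_intros =
  computable_in_const computable_in_nth computable_in_Suc computable_in_add computable_in_mult
  computable_in_diff computable_in_power computable_in_div_power2 decidable_in_oracle
  decidable_in_less decidable_in_eq decidable_in_not decidable_in_conj decidable_in_disj
  decidable_in_odd decidable_in_bit computable_in_if

lemma turing_reducibleI:
  assumes "decidable_in Y 1 (\<lambda>xs. X (xs ! 0))"
  shows "X \<le>\<^sub>T Y"
proof -
  obtain f where f: "\<And>xs. length xs = 1 \<Longrightarrow> rec_eval Y f xs (of_bool (X (xs ! 0)))"
    using assms unfolding computable_in_def by blast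
  show ?thesis
    unfolding turing_reducible_def using f[of "[n]" for n] by (auto split del: split_of_bool)
qed


section \<open>Stage-bounded evaluation\<close>

text \<open>The value \<open>0\<close> means that no result was found, \<open>Suc v\<close> that the result is \<open>v\<close>. The stage \<open>s\<close> bounds
  both the searches and the oracle queries. In the case of \<open>Mu\<close> the sum has at most one nonzero
  summand.\<close>

fun eval_upto :: "recf \<Rightarrow> nat \<Rightarrow> cantor \<Rightarrow> nat list \<Rightarrow> nat" where
  "eval_upto Zero s A xs = 1"
| "eval_upto Succ s A xs = (if length xs = 1 then Suc (Suc (xs ! 0)) else 0)"
| "eval_upto (Proj i) s A xs = (if i < length xs then Suc (xs ! i) else 0)"
| "eval_upto Oracle s A xs = (if length xs = 1 \<and> xs ! 0 < s then Suc (of_bool (A (xs ! 0))) else 0)"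
| "eval_upto (Comp f gs) s A xs =
    (if \<forall>g\<in>set gs. eval_upto g s A xs \<noteq> 0
     then eval_upto f s A (map (\<lambda>g. eval_upto g s A xs - 1) gs) else 0)"
| "eval_upto (Prec f g) s A [] = 0"
| "eval_upto (Prec f g) s A (n # xs) =
    rec_nat (eval_upto f s A xs)
      (\<lambda>m r. if r = 0 then 0 else eval_upto g s A (m # (r - 1) # xs)) n"
| "eval_upto (Mu f) s A xs =
    (\<Sum>n<s. if eval_upto f s A (n # xs) = 1 \<and> (\<forall>m<n. 1 < eval_upto f s A (m # xs))
      then Suc n else 0)"

text \<open>The use principle: queries at \<open>s\<close> or beyond count as failures, so a finite
  oracle coded by a number can stand in for \<open>A\<close>.\<close>

lemma eval_upto_cong:
  assumes "\<And>i. i < s \<Longrightarrow> A i = B i"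
  shows "eval_upto f s A xs = eval_upto f s B xs"
proof (induction f arbitrary: xs)
  case (Comp f gs)
  then show ?case by (simp del: neq0_conv cong: map_cong)
next
  case (Prec f g)
  then show ?case by (cases xs) (simp_all cong: if_cong)
qed (use assms in auto)

lemma sum_Suc_unique:
  fixes s :: nat
  assumes "n < s" "P n" "\<And>m. P m \<Longrightarrow> m = n"
  shows "(\<Sum>m<s. if P m then Suc m else 0) = Suc n"
proof -
  have "(\<Sum>m<s. if P m then Suc m else 0) = (\<Sum>m<s. if m = n then Suc m else 0)"
    by (intro sum.cong refl) (metis assms(2,3))
  also have "\<dots> = Suc n" using assms(1) by simp
  finally show ?thesis .
qed

lemma eval_upto_sound: "eval_upto f s A xs = Suc v \<Longrightarrow> rec_eval A f xs v"
proof (induction f arbitrary: xs v)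
  case Zero
  then show ?case by (auto intro: rec_eval.Zero)
next
  case Succ
  then show ?case by (auto simp: length_Suc_conv split: if_splits intro: rec_eval.Succ)
next
  case (Proj i)
  then show ?case by (auto split: if_splits intro: rec_eval.Proj)
next
  case Oracle
  then show ?case by (auto simp: length_Suc_conv split: if_splits split del: split_of_bool intro: rec_eval.Oracle)
next
  case (Comp f gs)
  then have *: "\<forall>g\<in>set gs. eval_upto g s A xs \<noteq> 0"
    "eval_upto f s A (map (\<lambda>g. eval_upto g s A xs - 1) gs) = Suc v"
    by (auto split: if_splits)
  show ?case
  proof (rule rec_eval.Comp)
    show "rec_eval A f (map (\<lambda>g. eval_upto g s A xs - 1) gs) v" using Comp.IH(1) *(2) .
    show "\<forall>i<length gs. rec_eval A (gs ! i) xs (map (\<lambda>g. eval_upto g s A xs - 1) gs ! i)"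
      using Comp.IH(2) *(1) by simp
  qed simp
next
  case (Prec f g)
  then obtain n ys where xs: "xs = n # ys" by (cases xs) auto
  have "rec_eval A (Prec f g) (n # ys) v" if "eval_upto (Prec f g) s A (n # ys) = Suc v" for v
    using that
  proof (induction n arbitrary: v)
    case 0
    then show ?case using Prec.IH(1) by (auto intro: rec_eval.Prec_0)
  next
    case (Suc n)
    define r where "r = eval_upto (Prec f g) s A (n # ys)"
    have r: "r \<noteq> 0" "eval_upto g s A (n # (r - 1) # ys) = Suc v"
      using Suc.prems by (auto simp: r_def split: if_splits)
    then show ?case
      using Suc.IH[of "r - 1"] Prec.IH(2) by (auto simp: r_def intro: rec_eval.Prec_Suc)
  qed
  then show ?case using Prec.prems xs by simp
next
  case (Mu f)
  define P where "P n \<longleftrightarrow> eval_upto f s A (n # xs) = 1 \<and> (\<forall>m<n. 1 < eval_upto f s A (m # xs))" for n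
  have eq: "(\<Sum>n<s. if P n then Suc n else 0) = Suc v"
    using Mu.prems by (simp add: P_def)
  have "\<exists>n<s. P n"
  proof (rule ccontr)
    assume "\<not> ?thesis"
    then have "(\<Sum>n<s. if P n then Suc n else 0) = 0" by simp
    with eq show False by simp
  qed
  then obtain n where n: "n < s" "P n" by blast
  have "(\<Sum>m<s. if P m then Suc m else 0) = Suc n"
  proof (rule sum_Suc_unique[of n s P, OF n])
    \<comment> \<open>The smaller of two distinct candidates would have value 1 and, as a
      predecessor of the other, a value above 1.\<close>
    show "m = n" if "P m" for m
      using that n(2) unfolding P_def by (metis linorder_neqE_nat less_irrefl)
  qed
  with eq n(2) have "P v" by (metis nat.inject)
  show ?case
  proof (rule rec_eval.Mu)
    show "rec_eval A f (v # xs) 0" using \<open>P v\<close> Mu.IH by (simp add: P_def)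
    show "\<forall>m<v. \<exists>k. rec_eval A f (m # xs) (Suc k)"
    proof (intro allI impI)
      fix m assume "m < v"
      then have "1 < eval_upto f s A (m # xs)" using \<open>P v\<close> by (simp add: P_def)
      then obtain k where "eval_upto f s A (m # xs) = Suc (Suc k)"
        by (auto simp: less_eq_Suc_le dest!: le_Suc_ex)
      then show "\<exists>k. rec_eval A f (m # xs) (Suc k)" using Mu.IH by blast
    qed
  qed
qed

text \<open>Convergence at all large stages lets finitely many premises be combined directly,
  without monotonicity in \<open>s\<close>. In the \<open>Mu\<close> case the stage must also exceed
  \<open>n\<close> for the bounded search to reach it.\<close>

lemma eval_upto_complete:
  "rec_eval A f xs v \<Longrightarrow> eventually (\<lambda>s. eval_upto f s A xs = Suc v) sequentially"
proof (induction rule: rec_eval.induct)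
  case (Oracle x)
  show ?case using eventually_gt_at_top[of x] by eventually_elim auto
next
  case (Comp ys gs xs f z)
  have "\<forall>\<^sub>F s in sequentially. \<forall>i\<in>{..<length gs}. eval_upto (gs ! i) s A xs = Suc (ys ! i)"
    using Comp.IH(1) by (intro eventually_ball_finite) auto
  with Comp.IH(2) show ?case
  proof eventually_elim
    case (elim s)
    have "map (\<lambda>g. eval_upto g s A xs - 1) gs = ys"
      using elim Comp.hyps by (intro nth_equalityI) auto
    moreover have "\<forall>g\<in>set gs. eval_upto g s A xs \<noteq> 0"
      using elim(2) by (auto simp: in_set_conv_nth)
    ultimately show ?case using elim(1) by simp
  qed
next
  case (Prec_Suc f g n xs r y)
  from Prec_Suc.IH show ?case by eventually_elim auto
next
  case (Mu f n xs)
  have "\<forall>\<^sub>F s in sequentially. \<forall>m\<in>{..<n}. 1 < eval_upto f s A (m # xs)"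
  proof (intro eventually_ball_finite ballI)
    fix m assume "m \<in> {..<n}"
    then obtain k where "\<forall>\<^sub>F s in sequentially. eval_upto f s A (m # xs) = Suc (Suc k)"
      using Mu.IH(2) by auto
    then show "\<forall>\<^sub>F s in sequentially. 1 < eval_upto f s A (m # xs)"
      by eventually_elim simp
  qed simp
  with Mu.IH(1) eventually_gt_at_top[of n] show ?case
  proof eventually_elim
    case (elim s)
    show ?case
      unfolding eval_upto.simps
    proof (rule sum_Suc_unique)
      fix m assume m: "eval_upto f s A (m # xs) = 1 \<and> (\<forall>j<m. 1 < eval_upto f s A (j # xs))"
      have "\<not> m < n" using m elim(3) by (metis lessThan_iff less_irrefl)
      moreover have "\<not> n < m" using m elim(1) by auto
      ultimately show "m = n" by simp
    qed (use elim in auto)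
  qed
qed auto

lemma computable_in_eval_upto_compose:
  assumes "computable_in A (length Gs + 2) (\<lambda>ys. eval_upto f (ys ! 0) (bit (ys ! 1)) (drop 2 ys))"
    and "computable_in A k S" "computable_in A k T" "\<And>G. G \<in> set Gs \<Longrightarrow> computable_in A k G"
  shows "computable_in A k (\<lambda>xs. eval_upto f (S xs) (bit (T xs)) (map (\<lambda>G. G xs) Gs))"
proof -
  have "computable_in A k (\<lambda>xs. (\<lambda>ys. eval_upto f (ys ! 0) (bit (ys ! 1)) (drop 2 ys))
      (map (\<lambda>G. G xs) (S # T # Gs)))"
    by (rule computable_in_compose[OF assms(1)]) (use assms in auto)
  then show ?thesis by simp
qed

text \<open>The oracle becomes data: the list holds the stage, a number whose bits are the oracle,
  and then the \<open>k\<close> arguments. Each code \<open>f\<close> gets its own function, by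
  induction; \<open>k\<close> is arbitrary because subprograms run at other arities. Where
  \<open>k\<close> does not fit the code, the value is constantly 0.\<close>

lemma computable_in_eval_upto:
  "computable_in A (k + 2) (\<lambda>ys. eval_upto f (ys ! 0) (bit (ys ! 1)) (drop 2 ys))"
proof (induction f arbitrary: k)
  case Zero
  then show ?case by (simp add: computable_in_const)
next
  case Succ
  show ?case
  proof (cases "k = 1")
    case True
    have "computable_in A (k + 2) (\<lambda>ys. Suc (Suc (ys ! 2)))"
      using True by (intro computable_in_intros) simp
    then show ?thesis by (rule computable_in_cong) (use True in simp)
  next
    case False
    then show ?thesis
      by (intro computable_in_cong[OF computable_in_const[of _ _ 0]]) simp
  qed
next
  case (Proj i)
  show ?case
  proof (cases "i < k")
    case True
    have "computable_in A (k + 2) (\<lambda>ys. Suc (ys ! (i + 2)))"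
      using True by (intro computable_in_intros) simp
    then show ?thesis by (rule computable_in_cong) (use True in \<open>simp add: add.commute\<close>)
  next
    case False
    then show ?thesis
      by (intro computable_in_cong[OF computable_in_const[of _ _ 0]]) simp
  qed
next
  case Oracle
  show ?case
  proof (cases "k = 1")
    case True
    have "computable_in A (k + 2)
      (\<lambda>ys. if ys ! 2 < ys ! 0 then Suc (of_bool (bit (ys ! 1) (ys ! 2))) else 0)"
      using True by (intro computable_in_intros) simp_all
    then show ?thesis by (rule computable_in_cong) (use True in simp)
  next
    case False
    then show ?thesis
      by (intro computable_in_cong[OF computable_in_const[of _ _ 0]]) simp
  qed
next
  case (Comp f gs)
  define Es where "Es = map (\<lambda>g ys. eval_upto g (ys ! 0) (bit (ys ! 1)) (drop 2 ys)) gs"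
  have Es: "computable_in A (k + 2) E" if "E \<in> set Es" for E
    using that Comp.IH(2) by (auto simp: Es_def)
  have "decidable_in A (k + 2) (\<lambda>ys. \<forall>P\<in>set (map (\<lambda>E ys. E ys \<noteq> 0) Es). P ys)"
  proof (rule decidable_in_ball_set)
    fix P assume "P \<in> set (map (\<lambda>E ys. E ys \<noteq> 0) Es)"
    then obtain E where E: "E \<in> set Es" "P = (\<lambda>ys. E ys \<noteq> 0)" by auto
    show "decidable_in A (k + 2) P"
      unfolding E(2) by (intro decidable_in_not decidable_in_eq Es E(1) computable_in_const)
  qed
  moreover have "computable_in A (k + 2) (\<lambda>ys. eval_upto f (ys ! 0) (bit (ys ! 1))
      (map (\<lambda>G. G ys) (map (\<lambda>E ys. E ys - 1) Es)))"
  proof (rule computable_in_eval_upto_compose[OF Comp.IH(1)])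
    fix G assume "G \<in> set (map (\<lambda>E ys. E ys - 1) Es)"
    then obtain E where E: "E \<in> set Es" "G = (\<lambda>ys. E ys - 1)" by auto
    show "computable_in A (k + 2) G"
      unfolding E(2) by (intro computable_in_diff Es E(1) computable_in_const)
  qed (auto intro: computable_in_nth)
  ultimately have "computable_in A (k + 2) (\<lambda>ys. if \<forall>P\<in>set (map (\<lambda>E ys. E ys \<noteq> 0) Es). P ys
      then eval_upto f (ys ! 0) (bit (ys ! 1)) (map (\<lambda>G. G ys) (map (\<lambda>E ys. E ys - 1) Es)) else 0)"
    by (intro computable_in_if computable_in_const)
  then show ?case
    by (rule computable_in_cong) (simp add: Es_def comp_def del: neq0_conv)
next
  case (Prec f g)
  show ?case
  proof (cases k)
    case 0
    then show ?thesis
      by (intro computable_in_cong[OF computable_in_const[of _ _ 0]]) simp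
  next
    case (Suc j)
    have F: "computable_in A (k + 2) (\<lambda>ys. eval_upto f (ys ! 0) (bit (ys ! 1))
        (map (\<lambda>G. G ys) (map (\<lambda>i ys. ys ! (i + 3)) [0..<j])))"
      by (rule computable_in_eval_upto_compose[OF Prec.IH(1)])
        (auto intro!: computable_in_nth simp: Suc)
    \<comment> \<open>The list is counter, accumulator, stage, oracle code, recursion argument,
      parameters, which gives the offsets 2, 3 and 5. A successful accumulator is one above the
      actual value, hence \<open>ys ! 1 - 1\<close>.\<close>
    have G: "computable_in A (Suc (Suc (k + 2))) (\<lambda>ys. if ys ! 1 = 0 then 0 else
        eval_upto g (ys ! 2) (bit (ys ! 3)) (map (\<lambda>G. G ys)
          ((\<lambda>ys. ys ! 0) # (\<lambda>ys. ys ! 1 - 1) # map (\<lambda>i ys. ys ! (i + 5)) [0..<j])))"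
      by (intro computable_in_if computable_in_eval_upto_compose[OF Prec.IH(2)])
        (auto intro!: computable_in_intros simp: Suc)
    have "computable_in A (k + 2) (\<lambda>ys. ys ! 2)" by (rule computable_in_nth) (simp add: Suc)
    from computable_in_rec_nat[OF this F G] show ?thesis
    proof (rule computable_in_cong)
      fix ys :: "nat list" assume len: "length ys = k + 2"
      then obtain s t n zs where ys: "ys = s # t # n # zs" "length zs = j"
        by (auto simp: Suc numeral_2_eq_2 length_Suc_conv)
      have eqs: "map (\<lambda>i. ys ! (i + 3)) [0..<j] = zs"
        "map (\<lambda>i. (m # r # ys) ! (i + 5)) [0..<j] = zs" for m r
        using ys by (auto intro!: nth_equalityI simp: numeral_eq_Suc)
      show "rec_nat (eval_upto f (ys ! 0) (bit (ys ! 1))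
          (map (\<lambda>G. G ys) (map (\<lambda>i ys. ys ! (i + 3)) [0..<j])))
        (\<lambda>n r. if (n # r # ys) ! 1 = 0 then 0 else
          eval_upto g ((n # r # ys) ! 2) (bit ((n # r # ys) ! 3)) (map (\<lambda>G. G (n # r # ys))
          ((\<lambda>ys. ys ! 0) # (\<lambda>ys. ys ! 1 - 1) # map (\<lambda>i ys. ys ! (i + 5)) [0..<j]))) (ys ! 2)
        = eval_upto (Prec f g) (ys ! 0) (bit (ys ! 1)) (drop 2 ys)"
        unfolding list.map map_map comp_def eqs
        by (simp add: ys cong: if_cong)
    qed
  qed
next
  case (Mu f)
  \<comment> \<open>Here \<open>j\<close> is the number of bound variables in front of the stage: 1
    for the summation index, 2 inside the bounded quantifier. The innermost one is the first
    argument of \<open>f\<close>.\<close>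
  have E: "computable_in A (k + j + 2) (\<lambda>ys. eval_upto f (ys ! j) (bit (ys ! Suc j))
      (map (\<lambda>G. G ys) ((\<lambda>ys. ys ! 0) # map (\<lambda>i ys. ys ! (i + (j + 2))) [0..<k])))" for j
    by (rule computable_in_eval_upto_compose[OF Mu])
      (auto intro!: computable_in_nth)
  have eqs: "map (\<lambda>i. (n # ys) ! (i + 3)) [0..<k] = drop 2 ys"
    "map (\<lambda>i. (m # n # ys) ! (i + 4)) [0..<k] = drop 2 ys" if "length ys = k + 2" for n m ys
    using that by (auto intro!: nth_equalityI simp: numeral_eq_Suc add.commute)
  have "computable_in A (k + 2) (\<lambda>ys. \<Sum>n<ys ! 0.
      (\<lambda>ys. if eval_upto f (ys ! 1) (bit (ys ! 2))
          (map (\<lambda>G. G ys) ((\<lambda>ys. ys ! 0) # map (\<lambda>i ys. ys ! (i + 3)) [0..<k])) = 1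
        \<and> (\<forall>m<ys ! 0. (\<lambda>ys. 1 < eval_upto f (ys ! 2) (bit (ys ! 3))
          (map (\<lambda>G. G ys) ((\<lambda>ys. ys ! 0) # map (\<lambda>i ys. ys ! (i + 4)) [0..<k]))) (m # ys))
        then Suc (ys ! 0) else 0) (n # ys))"
    by (intro computable_in_sum computable_in_if decidable_in_conj decidable_in_eq
        decidable_in_all_less decidable_in_less)
      (use E[of 1] E[of 2] in \<open>auto intro!: computable_in_intros simp: numeral_eq_Suc\<close>)
  then show ?case
  proof (rule computable_in_cong)
    fix ys :: "nat list" assume len: "length ys = k + 2"
    show "(\<Sum>n<ys ! 0.
      (\<lambda>ys. if eval_upto f (ys ! 1) (bit (ys ! 2))
          (map (\<lambda>G. G ys) ((\<lambda>ys. ys ! 0) # map (\<lambda>i ys. ys ! (i + 3)) [0..<k])) = 1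
        \<and> (\<forall>m<ys ! 0. (\<lambda>ys. 1 < eval_upto f (ys ! 2) (bit (ys ! 3))
          (map (\<lambda>G. G ys) ((\<lambda>ys. ys ! 0) # map (\<lambda>i ys. ys ! (i + 4)) [0..<k]))) (m # ys))
        then Suc (ys ! 0) else 0) (n # ys))
      = eval_upto (Mu f) (ys ! 0) (bit (ys ! 1)) (drop 2 ys)"
      unfolding list.map map_map comp_def eqs[OF len] by (simp cong: if_cong)
  qed
qed

section \<open>Cylinders in Cantor space\<close>

text \<open>The least significant bit comes first, so \<open>bit\<close> recovers the sequence and
  shortening a prefix is reduction modulo a power of 2. A number, rather than a list, can be an
  argument of a program.\<close>

definition prefix_code :: "nat \<Rightarrow> cantor \<Rightarrow> nat" where
  "prefix_code t X = horner_sum of_bool 2 (map X [0..<t])"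

lemma prefix_code_less: "prefix_code t X < 2 ^ t"
  using horner_sum_of_bool_2_less[of "map X [0..<t]", where 'a = nat] by (simp add: prefix_code_def)

lemma bit_prefix_code: "bit (prefix_code t X) i \<longleftrightarrow> i < t \<and> X i"
  by (auto simp: prefix_code_def bit_horner_sum_bit_iff)

lemma bit_imp_less_of_less_power2:
  fixes c :: nat
  assumes "c < 2 ^ t" "bit c i"
  shows "i < t"
proof (rule ccontr)
  assume "\<not> i < t"
  then have "(2::nat) ^ t \<le> 2 ^ i" by (intro power_increasing) auto
  with assms(1) have "c < 2 ^ i" by linarith
  then have "c div 2 ^ i = 0" by simp
  then show False using assms(2) by (simp add: bit_iff_odd)
qed

lemma prefix_code_eq_iff:
  assumes "c < 2 ^ t"
  shows "prefix_code t X = c \<longleftrightarrow> (\<forall>i<t. X i = bit c i)"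
  unfolding bit_eq_iff bit_prefix_code using bit_imp_less_of_less_power2[OF assms] by auto

lemma prefix_code_eq_prefix_code_iff:
  "prefix_code t X = prefix_code t Y \<longleftrightarrow> (\<forall>i<t. X i = Y i)"
  by (auto simp: bit_eq_iff bit_prefix_code)

lemma prefix_code_mod:
  assumes "s \<le> t"
  shows "prefix_code t X mod 2 ^ s = prefix_code s X"
  using assms by (auto simp: bit_eq_iff bit_prefix_code bit_take_bit_iff simp flip: take_bit_eq_mod)

lemma open_prefix: "open {X. prefix_code t X \<in> V}"
proof -
  have cyl: "open {X :: cantor. \<forall>i<t. X i = Y i}" for Y
  proof -
    have "open ((\<lambda>X :: cantor. X i) -` {Y i})" for i
      by (rule open_vimage) (auto simp: Topological_Spaces.open_discrete)
    then have "open (\<Inter>i\<in>{..<t}. (\<lambda>X :: cantor. X i) -` {Y i})" by (intro open_INT) auto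
    moreover have "(\<Inter>i\<in>{..<t}. (\<lambda>X :: cantor. X i) -` {Y i}) = {X. \<forall>i<t. X i = Y i}" by auto
    ultimately show ?thesis by simp
  qed
  have "open (\<Union>Y\<in>{Y. prefix_code t Y \<in> V}. {X. \<forall>i<t. X i = Y i})"
    using cyl by blast
  moreover have "(\<Union>Y\<in>{Y. prefix_code t Y \<in> V}. {X. \<forall>i<t. X i = Y i}) = {X. prefix_code t X \<in> V}"
    by (auto simp flip: prefix_code_eq_prefix_code_iff)
  ultimately show ?thesis by simp
qed

lemma open_cantor_iff:
  "open U \<longleftrightarrow> (\<forall>X\<in>U. \<exists>t. \<forall>Y. prefix_code t Y = prefix_code t X \<longrightarrow> Y \<in> U)"
proof
  assume "open U"
  show "\<forall>X\<in>U. \<exists>t. \<forall>Y. prefix_code t Y = prefix_code t X \<longrightarrow> Y \<in> U"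
  proof
    fix X assume "X \<in> U"
    have "openin (product_topology (\<lambda>i. euclidean) UNIV) U"
      using \<open>open U\<close> by (simp add: euclidean_product_topology)
    from product_topology_open_contains_basis[OF this \<open>X \<in> U\<close>]
    obtain B where B: "X \<in> Pi\<^sub>E UNIV B" "finite {i. B i \<noteq> UNIV}" "Pi\<^sub>E UNIV B \<subseteq> U"
      by auto
    then obtain t where t: "\<And>i. B i \<noteq> UNIV \<Longrightarrow> i < t"
      unfolding finite_nat_set_iff_bounded by auto
    have "Y \<in> U" if "prefix_code t Y = prefix_code t X" for Y
    proof -
      have "Y i \<in> B i" for i
        using that t[of i] B(1) by (cases "B i = UNIV") (auto simp: prefix_code_eq_prefix_code_iff)
      then show ?thesis using B(3) by (auto simp: PiE_UNIV_domain)
    qed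
    then show "\<exists>t. \<forall>Y. prefix_code t Y = prefix_code t X \<longrightarrow> Y \<in> U" by blast
  qed
next
  assume U: "\<forall>X\<in>U. \<exists>t. \<forall>Y. prefix_code t Y = prefix_code t X \<longrightarrow> Y \<in> U"
  show "open U"
  proof (subst open_subopen, rule ballI)
    fix X assume "X \<in> U"
    then obtain t where "\<And>Y. prefix_code t Y = prefix_code t X \<Longrightarrow> Y \<in> U" using U by blast
    then show "\<exists>T. open T \<and> X \<in> T \<and> T \<subseteq> U"
      by (intro exI[of _ "{Y. prefix_code t Y \<in> {prefix_code t X}}"] conjI open_prefix) auto
  qed
qed

lemma compact_cantor: "compact (UNIV :: cantor set)"
proof -
  have "compact_space (product_topology (\<lambda>i. euclidean :: bool topology) (UNIV :: nat set))"
    unfolding compact_space_product_topology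
    by (simp add: compact_space_def finite_imp_compact)
  then show ?thesis by (simp add: euclidean_product_topology compact_space_def)
qed

text \<open>Membership in \<open>K\<close> is locally constant, with \<open>l X\<close> bits
  sufficing near \<open>X\<close>. By compactness finitely many of these lengths serve all points,
  and their maximum is \<open>t\<close>.\<close>

lemma clopen_cantor_prefix:
  assumes "open K" "open (- K)"
  obtains t V where "K = {X. prefix_code t X \<in> V}"
proof -
  have "\<exists>t. \<forall>Y. prefix_code t Y = prefix_code t X \<longrightarrow> (Y \<in> K \<longleftrightarrow> X \<in> K)" for X
    using assms unfolding open_cantor_iff by (cases "X \<in> K") (auto 4 4)
  then obtain l where l: "\<And>X Y. prefix_code (l X) Y = prefix_code (l X) X \<Longrightarrow> Y \<in> K \<longleftrightarrow> X \<in> K"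
    by metis
  have "UNIV \<subseteq> (\<Union>X\<in>UNIV. {Y. prefix_code (l X) Y \<in> {prefix_code (l X) X}})" by auto
  then obtain F where F: "finite F"
    "UNIV \<subseteq> (\<Union>X\<in>F. {Y. prefix_code (l X) Y \<in> {prefix_code (l X) X}})"
    by (rule compactE_image[OF compact_cantor, rotated]) (blast intro: open_prefix)+
  define t where "t = Max (insert 0 (l ` F))"
  have t: "l X \<le> t" if "X \<in> F" for X using F(1) that by (auto simp: t_def)
  have "Y \<in> K" if "prefix_code t Y = prefix_code t Z" "Z \<in> K" for Y Z
  proof -
    obtain X where X: "X \<in> F" "prefix_code (l X) Z = prefix_code (l X) X" using F(2) by auto
    then have "prefix_code (l X) Y = prefix_code (l X) X"
      using t[OF X(1)] that(1) by (auto simp: prefix_code_eq_prefix_code_iff)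
    then show ?thesis using l X(2) that(2) by blast
  qed
  then have "K = {X. prefix_code t X \<in> prefix_code t ` K}" by auto
  then show thesis by (rule that)
qed


section \<open>Bernoulli measures of cylinders\<close>

lemma space_bernoulli_measure [simp]: "space (bernoulli_measure p) = UNIV"
  by (simp add: bernoulli_measure_def space_PiM)

lemma prob_space_bernoulli_measure: "prob_space (bernoulli_measure p)"
  unfolding bernoulli_measure_def
  by (intro prob_space_PiM) (simp add: measure_pmf.prob_space_axioms)

text \<open>Polymorphic because it is used at reals for measures, at polynomials for the dependence
  on the bias, and at naturals for computable lower bounds.\<close>

definition string_weight :: "'a \<Rightarrow> 'a \<Rightarrow> nat \<Rightarrow> nat \<Rightarrow> 'a::comm_monoid_mult" where
  "string_weight a b t c = (\<Prod>i<t. if bit c i then a else b)"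

text \<open>The expansion of the power without collecting terms: the top bit contributes a factor
  \<open>a\<close> or \<open>b\<close>. Besides \<open>a + b = 1\<close> it is applied to rounded
  weights, where \<open>a + b\<close> falls short of 1.\<close>

lemma sum_string_weight:
  fixes a b :: "'a::comm_ring_1"
  shows "(\<Sum>c<2 ^ t. string_weight a b t c) = (a + b) ^ t"
proof (induction t)
  case 0
  then show ?case by (simp add: string_weight_def)
next
  case (Suc t)
  have split: "{..<2 ^ Suc t} = {..<2 ^ t} \<union> (\<lambda>c. c + 2 ^ t) ` {..<2 ^ t :: nat}" (is "?l = ?r")
  proof (intro set_eqI iffI)
    fix x :: nat assume "x \<in> ?l"
    then show "x \<in> ?r" by (cases "x < 2 ^ t") (auto intro!: image_eqI[of _ _ "x - 2 ^ t"])
  qed auto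
  have low: "string_weight a b (Suc t) c = string_weight a b t c * b" if "c < 2 ^ t" for c
    using bit_imp_less_of_less_power2[OF that, of t] by (auto simp: string_weight_def)
  have high: "string_weight a b (Suc t) (c + 2 ^ t) = string_weight a b t c * a" if c: "c < 2 ^ t" for c
  proof -
    have "bit (c + 2 ^ t) t" using c by (simp add: bit_iff_odd)
    moreover have "bit (c + 2 ^ t) i \<longleftrightarrow> bit c i" if "i < t" for i
    proof -
      have "take_bit t (c + 2 ^ t) = take_bit t c" by (simp add: take_bit_eq_mod)
      then show ?thesis using that by (metis bit_take_bit_iff)
    qed
    ultimately show ?thesis by (simp add: string_weight_def)
  qed
  have "(\<Sum>c<2 ^ Suc t. string_weight a b (Suc t) c)
    = (\<Sum>c<2 ^ t. string_weight a b (Suc t) c) + (\<Sum>c<2 ^ t. string_weight a b (Suc t) (c + 2 ^ t))"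
    unfolding split by (subst sum.union_disjoint) (auto simp: sum.reindex)
  also have "\<dots> = (\<Sum>c<2 ^ t. string_weight a b t c * b) + (\<Sum>c<2 ^ t. string_weight a b t c * a)"
    using low high by (intro arg_cong2[of _ _ _ _ "(+)"] sum.cong) auto
  also have "\<dots> = (a + b) ^ Suc t"
    by (simp only: sum_distrib_right[symmetric] Suc.IH) (simp add: algebra_simps)
  finally show ?case .
qed

lemma measure_prefix_code_eq:
  assumes p: "p \<in> {0..1}" and c: "c < 2 ^ t"
  shows "measure (bernoulli_measure p) {X. prefix_code t X = c} = string_weight p (1 - p) t c"
proof -
  have "{X. prefix_code t X = c}
    = prod_emb UNIV (\<lambda>_. measure_pmf (bernoulli_pmf p)) {..<t} (Pi\<^sub>E {..<t} (\<lambda>i. {bit c i}))"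
    by (auto simp: prefix_code_eq_iff[OF c] prod_emb_def restrict_def PiE_iff extensional_def)
  then have "emeasure (bernoulli_measure p) {X. prefix_code t X = c}
    = (\<Prod>i<t. emeasure (measure_pmf (bernoulli_pmf p)) {bit c i})"
    unfolding bernoulli_measure_def
    by (simp only:) (rule emeasure_PiM_emb; simp add: measure_pmf.prob_space_axioms)
  also have "\<dots> = (\<Prod>i<t. ennreal (if bit c i then p else 1 - p))"
    using p by (intro prod.cong) (auto simp: emeasure_pmf_single)
  also have "\<dots> = ennreal (string_weight p (1 - p) t c)"
    unfolding string_weight_def using p by (subst prod_ennreal) auto
  finally show ?thesis
    using p by (simp add: measure_def string_weight_def prod_nonneg)
qed

lemma measure_prefix_code_in:
  assumes p: "p \<in> {0..1}"
  shows "measure (bernoulli_measure p) {X. prefix_code t X \<in> V}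
    = (\<Sum>c\<in>{..<2 ^ t} \<inter> V. string_weight p (1 - p) t c)"
proof -
  interpret prob_space "bernoulli_measure p" by (rule prob_space_bernoulli_measure)
  have "{X. prefix_code t X \<in> V} = (\<Union>c\<in>{..<2 ^ t} \<inter> V. {X. prefix_code t X = c})"
    using prefix_code_less by auto
  also have "prob \<dots> = (\<Sum>c\<in>{..<2 ^ t} \<inter> V. prob {X. prefix_code t X = c})"
  proof (rule finite_measure_finite_Union)
    have "{X. prefix_code t X = c} \<in> sets borel" for c
      using open_prefix[of t "{c}"] by (intro borel_open) simp
    then show "(\<lambda>c. {X. prefix_code t X = c}) ` ({..<2 ^ t} \<inter> V) \<subseteq> events"
      by (auto simp: sets_bernoulli_measure)
  qed (auto simp: disjoint_family_on_def)
  also have "\<dots> = (\<Sum>c\<in>{..<2 ^ t} \<inter> V. string_weight p (1 - p) t c)"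
    using measure_prefix_code_eq[OF p] by (intro sum.cong) auto
  finally show ?thesis .
qed


section \<open>From infinitely many biases to all biases\<close>

lemma coeff_mult_Ints:
  assumes "\<And>i. coeff a i \<in> \<int>" "\<And>i. coeff b i \<in> \<int>"
  shows "coeff (a * b) i \<in> \<int>"
  unfolding coeff_mult using assms by (intro Ints_sum Ints_mult) auto

lemma coeff_prod_Ints:
  assumes "\<And>x i. x \<in> S \<Longrightarrow> coeff (f x) i \<in> \<int>"
  shows "coeff (\<Prod>x\<in>S. f x) i \<in> \<int>"
  using assms
proof (induction S arbitrary: i rule: infinite_finite_induct)
  case (insert x S)
  then show ?case by (simp add: coeff_mult_Ints)
qed auto

lemma clopen_measure_poly:
  assumes "open K" "open (- K)"
  obtains P :: "real poly" where "\<And>i. coeff P i \<in> \<int>"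
    "\<And>p. p \<in> {0..1} \<Longrightarrow> measure (bernoulli_measure p) K = poly P p"
proof -
  obtain t V where K: "K = {X. prefix_code t X \<in> V}"
    using assms by (rule clopen_cantor_prefix)
  define P :: "real poly" where
    "P = (\<Sum>c\<in>{..<2 ^ t} \<inter> V. string_weight [:0, 1:] [:1, -1:] t c)"
  have "coeff P i \<in> \<int>" for i
    unfolding P_def coeff_sum string_weight_def
    by (intro Ints_sum coeff_prod_Ints) (auto simp: coeff_pCons split: nat.split)
  moreover have "measure (bernoulli_measure p) K = poly P p" if "p \<in> {0..1}" for p
    unfolding K measure_prefix_code_in[OF that] P_def string_weight_def poly_sum poly_prod
    by (intro sum.cong prod.cong) auto
  ultimately show thesis by (rule that)
qed

text \<open>By continuity the preimage of a clopen \<open>K\<close> is clopen, so both measures are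
  polynomials in the bias, and their difference vanishes at every preserved bias. Infinitely many
  roots make it zero; so does one transcendental root, because the coefficients are
  integers.\<close>

lemma bernoulli_preserving_all:
  assumes cont: "continuous_on UNIV \<phi>"
    and Q: "infinite {p\<in>{0<..<1}. bernoulli_preserving p \<phi>} \<or>
         (\<exists>p\<in>{0<..<1}. \<not> algebraic p \<and> bernoulli_preserving p \<phi>)"
    and p: "p \<in> {0..1}"
  shows "bernoulli_preserving p \<phi>"
proof -
  have clopen: "measure (bernoulli_measure p) (\<phi> -` K) = measure (bernoulli_measure p) K"
    if K: "open K" "open (- K)" for K
  proof -
    obtain P1 :: "real poly" where P1: "\<And>i. coeff P1 i \<in> \<int>"
      "\<And>q. q \<in> {0..1} \<Longrightarrow> measure (bernoulli_measure q) K = poly P1 q"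
      using K by (rule clopen_measure_poly) blast
    have "open (\<phi> -` K)" "open (- (\<phi> -` K))"
      using open_vimage[OF K(1) cont] open_vimage[OF K(2) cont] by (simp_all add: vimage_Compl)
    then obtain P2 :: "real poly" where P2: "\<And>i. coeff P2 i \<in> \<int>"
      "\<And>q. q \<in> {0..1} \<Longrightarrow> measure (bernoulli_measure q) (\<phi> -` K) = poly P2 q"
      by (rule clopen_measure_poly) blast
    have root: "poly (P2 - P1) q = 0" if "q \<in> {0<..<1}" "bernoulli_preserving q \<phi>" for q
    proof -
      have "measure (bernoulli_measure q) (\<phi> -` K) = measure (bernoulli_measure q) K"
        using that(2) borel_open[OF K(1)] by (simp only: bernoulli_preserving_def measure_def)
      then show ?thesis using that(1) P1(2)[of q] P2(2)[of q] by simp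
    qed
    have "P2 - P1 = 0"
    proof (rule ccontr)
      assume nz: "P2 - P1 \<noteq> 0"
      have "finite {p\<in>{0<..<1}. bernoulli_preserving p \<phi>}"
        by (rule finite_subset[OF _ poly_roots_finite[OF nz]]) (use root in auto)
      with Q obtain q where q: "q \<in> {0<..<1}" "\<not> algebraic q" "bernoulli_preserving q \<phi>" by auto
      have "algebraic q"
        using P1(1) P2(1) by (intro algebraicI[OF _ nz root[OF q(1,3)]]) simp
      then show False using q(2) by simp
    qed
    then show ?thesis using P1(2)[OF p] P2(2)[OF p] by simp
  qed
  interpret prob_space "bernoulli_measure p" by (rule prob_space_bernoulli_measure)
  have meas: "\<phi> \<in> measurable (bernoulli_measure p) (bernoulli_measure p)"
    using borel_measurable_continuous_onI[OF cont]
    by (simp add: measurable_def sets_bernoulli_measure)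
  \<comment> \<open>Finite-dimensional cylinders are clopen and determine a finite measure on the
    product, so agreement on clopen sets extends to Borel sets.\<close>
  have "distr (bernoulli_measure p) (bernoulli_measure p) \<phi> = bernoulli_measure p"
  proof (rule measure_eqI_PiM_infinite)
    show "sets (distr (bernoulli_measure p) (bernoulli_measure p) \<phi>)
        = sets (\<Pi>\<^sub>M n\<in>UNIV. measure_pmf (bernoulli_pmf p))"
      "sets (bernoulli_measure p) = sets (\<Pi>\<^sub>M n\<in>UNIV. measure_pmf (bernoulli_pmf p))"
      by (simp_all add: bernoulli_measure_def)
    interpret D: prob_space "distr (bernoulli_measure p) (bernoulli_measure p) \<phi>"
      using meas by (rule prob_space_distr)
    show "finite_measure (distr (bernoulli_measure p) (bernoulli_measure p) \<phi>)"
      by unfold_locales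
    fix A :: "nat \<Rightarrow> bool set" and J :: "nat set" assume J: "finite J"
    define K where "K = prod_emb UNIV (\<lambda>_. measure_pmf (bernoulli_pmf p)) J (Pi\<^sub>E J A)"
    obtain t where t: "\<And>i. i \<in> J \<Longrightarrow> i < t"
      using J unfolding finite_nat_set_iff_bounded by auto
    have "K = {X. \<forall>i\<in>J. X i \<in> A i}"
      by (auto simp: K_def prod_emb_def restrict_def PiE_iff extensional_def)
    then have K: "K = {X. prefix_code t X \<in> {c. \<forall>i\<in>J. bit c i \<in> A i}}"
      using t by (auto simp: bit_prefix_code)
    have op: "open K" unfolding K by (rule open_prefix)
    have "- K = {X. prefix_code t X \<in> - {c. \<forall>i\<in>J. bit c i \<in> A i}}" unfolding K by auto
    then have "open (- K)" by (simp only: open_prefix)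
    with op have "emeasure (bernoulli_measure p) (\<phi> -` K) = emeasure (bernoulli_measure p) K"
      using clopen by (simp add: emeasure_eq_measure)
    then show "emeasure (distr (bernoulli_measure p) (bernoulli_measure p) \<phi>) K
      = emeasure (bernoulli_measure p) K"
      using op by (subst emeasure_distr[OF meas]) (auto simp: sets_bernoulli_measure)
  qed
  then have "emeasure (bernoulli_measure p) (\<phi> -` U) = emeasure (bernoulli_measure p) U"
    if "U \<in> sets borel" for U
    using that emeasure_distr[OF meas, of U] by (simp add: sets_bernoulli_measure)
  then show ?thesis by (simp add: bernoulli_preserving_def)
qed


section \<open>Sampling computes the bias\<close>

text \<open>The integer part of \<open>4 ^ k * bias Z\<close>.\<close>

primrec bias_numerator :: "cantor \<Rightarrow> nat \<Rightarrow> nat" where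
  "bias_numerator Z 0 = 0"
| "bias_numerator Z (Suc k) = 4 * bias_numerator Z k + 1 + of_bool (Z k)"

definition bias :: "cantor \<Rightarrow> real" where
  "bias Z = (\<Sum>n. (1 + of_bool (Z n)) / 4 ^ Suc n)"

text \<open>The remainder is the bias of the shifted sequence. The expansions with all digits 1 and
  all digits 2 have the values 1/3 and 2/3, so the remainder stays 1/3 away from both neighbouring
  integers.\<close>

lemma bias_numerator_bounds:
  "1 / 3 \<le> 4 ^ k * bias Z - bias_numerator Z k" "4 ^ k * bias Z - bias_numerator Z k \<le> 2 / 3"
proof -
  define d :: "cantor \<Rightarrow> nat \<Rightarrow> real" where "d Z n = (1 + of_bool (Z n)) / 4 ^ Suc n" for Z n
  have geo: "(\<lambda>n. c / 4 ^ Suc n) sums (c / 3)" for c :: real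
  proof -
    have "(\<lambda>n. (c / 4) * (1 / 4) ^ n) sums ((c / 4) * (1 / (1 - 1 / 4)))"
      by (intro sums_mult geometric_sums) simp
    then show ?thesis by (simp add: field_simps power_divide)
  qed
  have summable: "summable (d Z)" for Z
  proof (rule summable_comparison_test')
    show "summable (\<lambda>n. 2 / 4 ^ Suc n :: real)" using geo sums_summable by blast
    show "norm (d Z n) \<le> 2 / 4 ^ Suc n" if "n \<ge> 0" for n
      by (cases "Z n") (auto simp: d_def field_simps)
  qed
  have bounds: "1 / 3 \<le> suminf (d Z)" "suminf (d Z) \<le> 2 / 3" for Z
  proof -
    have "(\<Sum>n. 1 / 4 ^ Suc n) \<le> suminf (d Z)"
      using geo[of 1] by (intro suminf_le summable) (auto simp: d_def sums_iff field_simps)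
    then show "1 / 3 \<le> suminf (d Z)" using geo[of 1] by (simp add: sums_iff)
    have "suminf (d Z) \<le> (\<Sum>n. 2 / 4 ^ Suc n)"
      using geo[of 2] by (intro suminf_le summable) (auto simp: d_def sums_iff field_simps)
    then show "suminf (d Z) \<le> 2 / 3" using geo[of 2] by (simp add: sums_iff)
  qed
  have tail: "4 ^ k * bias Z - bias_numerator Z k = suminf (d (\<lambda>n. Z (n + k)))"
  proof -
    have "bias Z = (\<Sum>n. d Z (n + k)) + (\<Sum>n<k. d Z n)"
      unfolding bias_def d_def[symmetric] by (rule suminf_split_initial_segment[OF summable])
    moreover have "4 ^ k * (\<Sum>n<k. d Z n) = bias_numerator Z k"
    proof (induction k)
      case (Suc k)
      have "4 ^ Suc k * (\<Sum>n<Suc k. d Z n) = 4 * (4 ^ k * (\<Sum>n<k. d Z n)) + 4 ^ Suc k * d Z k"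
        by (simp add: algebra_simps)
      also have "4 ^ Suc k * d Z k = 1 + of_bool (Z k)" by (simp add: d_def)
      finally show ?case by (simp add: Suc.IH)
    qed simp
    moreover have "4 ^ k * (\<Sum>n. d Z (n + k)) = suminf (d (\<lambda>n. Z (n + k)))"
    proof -
      have "4 ^ k * (\<Sum>n. d Z (n + k)) = (\<Sum>n. 4 ^ k * d Z (n + k))"
        using summable by (intro suminf_mult[symmetric]) simp
      also have "\<dots> = suminf (d (\<lambda>n. Z (n + k)))"
        by (intro suminf_cong) (simp add: d_def power_add)
      finally show ?thesis .
    qed
    ultimately show ?thesis by (simp add: algebra_simps)
  qed
  show "1 / 3 \<le> 4 ^ k * bias Z - bias_numerator Z k" "4 ^ k * bias Z - bias_numerator Z k \<le> 2 / 3"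
    unfolding tail by (rule bounds)+
qed

lemma bias_bounds: "bias Z \<in> {1 / 3..2 / 3}"
  using bias_numerator_bounds[of 0 Z] by simp

text \<open>Hoeffding's inequality for the coordinates, which are independent with values 0 and 1.
  The explicit rate allows sample sizes to be fixed in advance, without knowledge of the
  bias.\<close>

lemma prob_bernoulli_sum_deviation:
  assumes p: "p \<in> {0..1}" and N: "N > 0" and e: "\<epsilon> \<ge> 0"
  shows "measure (bernoulli_measure p) {X. \<epsilon> \<le> \<bar>(\<Sum>i<N. of_bool (X i)) - real N * p\<bar>}
    \<le> 2 * exp (- 2 * \<epsilon>\<^sup>2 / N)"
proof -
  interpret prob_space "bernoulli_measure p" by (rule prob_space_bernoulli_measure)
  define B where "B = measure_pmf (bernoulli_pmf p)"
  interpret B: product_prob_space "\<lambda>_::nat. B" UNIV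
    by unfold_locales (auto simp: B_def measure_pmf.emeasure_space_1)
  have M: "bernoulli_measure p = Pi\<^sub>M UNIV (\<lambda>_. B)" by (simp add: bernoulli_measure_def B_def)
  have coord: "(\<lambda>X. X i) \<in> measurable (bernoulli_measure p) B" for i :: nat
    unfolding M by (rule measurable_component_singleton) simp
  have distr: "distr (bernoulli_measure p) B (\<lambda>X. X i) = B" for i
    unfolding M by (rule B.PiM_component) simp
  have "indep_vars (\<lambda>_. B) (\<lambda>i X. X i) UNIV"
  proof (subst indep_vars_iff_distr_eq_PiM')
    have "distr (bernoulli_measure p) (Pi\<^sub>M UNIV (\<lambda>i. B)) (\<lambda>X. X) = bernoulli_measure p"
      unfolding M by (rule distr_id)
    then show "distr (bernoulli_measure p) (Pi\<^sub>M UNIV (\<lambda>i. B)) (\<lambda>X. \<lambda>i\<in>UNIV. X i)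
      = (\<Pi>\<^sub>M i\<in>UNIV. distr (bernoulli_measure p) B (\<lambda>X. X i))"
      by (simp only: distr restrict_UNIV) (simp only: M)
  qed (auto intro: coord)
  then have "indep_vars (\<lambda>_. B) (\<lambda>i X. X i) {..<N}" by (rule indep_vars_subset) simp
  then have indep: "indep_vars (\<lambda>_. borel) (\<lambda>i X. of_bool (X i) :: real) {..<N}"
    by (rule indep_vars_compose2) (simp add: B_def)
  have E: "expectation (\<lambda>X. of_bool (X i)) = p" for i
  proof -
    have "expectation (\<lambda>X. of_bool (X i))
      = integral\<^sup>L (distr (bernoulli_measure p) B (\<lambda>X. X i)) (of_bool :: bool \<Rightarrow> real)"
      by (subst integral_distr[OF coord]) (auto simp: B_def)
    also have "\<dots> = p" unfolding distr using p by (simp add: B_def)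
    finally show ?thesis .
  qed
  interpret H: Hoeffding_ineq "bernoulli_measure p" "{..<N}" "\<lambda>i X. of_bool (X i)"
    "\<lambda>_. 0" "\<lambda>_. 1" "real N * p"
    by unfold_locales (auto simp: indep E)
  show ?thesis using H.Hoeffding_ineq_abs_ge[OF e] N by simp
qed

text \<open>With \<open>64^(n+3)\<close> samples the frequency determines the first \<open>n + 1\<close> base-4 digits of the bias: since
  the digits are 1 or 2, the bias stays away from the endpoints of the base-4 intervals. The last of
  these digits is even iff \<open>Z n\<close> holds.\<close>

lemma turing_reducible_from_sample:
  assumes X: "\<And>n. \<bar>(\<Sum>i<2 ^ (6 * n + 18). of_bool (X i)) - 2 ^ (6 * n + 18) * bias Z\<bar> < (16::real) ^ (n + 3)"
  shows "Z \<le>\<^sub>T X"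
proof (rule turing_reducibleI)
  define c where "c n = (\<Sum>i<2 ^ (6 * n + 18). of_bool (X i) :: nat)" for n
  have Z: "Z n \<longleftrightarrow> \<not> odd (c n div 2 ^ (4 * n + 16))" for n
  proof -
    have e1: "(2::real) ^ (6 * n + 18) = 16 ^ (n + 4) * 4 ^ Suc n"
    proof -
      have "(16::real) ^ (n + 4) * 4 ^ Suc n = (2 ^ 4) ^ (n + 4) * (2 ^ 2) ^ Suc n" by simp
      also have "\<dots> = 2 ^ (4 * (n + 4) + 2 * Suc n)"
        by (simp only: power_mult[symmetric] power_add[symmetric])
      also have "4 * (n + 4) + 2 * Suc n = 6 * n + 18" by simp
      finally show ?thesis by simp
    qed
    have e2: "(2::real) ^ (4 * n + 16) = 16 ^ (n + 4)"
    proof -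
      have "(16::real) ^ (n + 4) = (2 ^ 4) ^ (n + 4)" by simp
      also have "\<dots> = 2 ^ (4 * (n + 4))" by (simp only: power_mult[symmetric])
      also have "4 * (n + 4) = 4 * n + 16" by simp
      finally show ?thesis by simp
    qed
    \<comment> \<open>There are \<open>D * 4 ^ Suc n\<close> samples and the tolerance is
      \<open>D / 16\<close>, so the count divided by \<open>D\<close> gives
      \<open>4 ^ Suc n * bias Z\<close> up to 1/16, less than the margin 1/3. As \<open>D\<close> is
      a power of 2, the integer part is found by shifting.\<close>
    define D :: real where "D = 16 ^ (n + 4)"
    define b where "b = bias_numerator Z (Suc n)"
    have D: "D > 0" by (simp add: D_def)
    have "\<bar>real (c n) - D * (4 ^ Suc n * bias Z)\<bar> < D / 16"
    proof -
      have "real (c n) = (\<Sum>i<2 ^ (6 * n + 18). of_bool (X i))" by (simp add: c_def)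
      moreover have "D = 16 * 16 ^ (n + 3)" by (simp add: D_def power_add)
      ultimately show ?thesis using X[of n] unfolding e1 D_def[symmetric] by (simp only: mult.assoc)
    qed
    then have "\<bar>(real (c n) - D * (4 ^ Suc n * bias Z)) / D\<bar> < 1 / 16"
      using D by (simp add: abs_div pos_divide_less_eq)
    then have "\<bar>real (c n) / D - 4 ^ Suc n * bias Z\<bar> < 1 / 16"
      using D by (simp add: diff_divide_distrib)
    then have "real b \<le> real (c n) / D" "real (c n) / D < real b + 1"
      using bias_numerator_bounds[of "Suc n" Z] unfolding b_def by linarith+
    then have "\<lfloor>real (c n) / D\<rfloor> = int b" by (intro floor_unique) auto
    moreover have "real (c n) / D = real (c n) / real (2 ^ (4 * n + 16))" by (simp add: D_def e2)
    ultimately have "c n div 2 ^ (4 * n + 16) = b"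
      using floor_divide_of_nat_eq[of "c n" "2 ^ (4 * n + 16)", where 'a = real] by (simp only: of_nat_eq_iff)
    moreover have "odd b \<longleftrightarrow> \<not> Z n" by (simp add: b_def)
    ultimately show ?thesis by simp
  qed
  have "decidable_in X 1 (\<lambda>xs. \<not> odd ((\<Sum>i<2 ^ (6 * xs ! 0 + 18). of_bool (X ((i # xs) ! 0)) :: nat)
      div 2 ^ (4 * xs ! 0 + 16)))"
    by (intro decidable_in_not decidable_in_odd computable_in_div_power2 computable_in_sum
        decidable_in_oracle computable_in_power computable_in_add computable_in_mult
        computable_in_const computable_in_nth) simp_all
  then show "decidable_in X 1 (\<lambda>xs. Z (xs ! 0))"
    by (simp add: Z c_def)
qed

text \<open>With \<open>64 ^ (n + 3)\<close> samples and tolerance \<open>16 ^ (n + 3)\<close> the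
  Hoeffding exponent is \<open>- 2 * 4 ^ (n + 3)\<close>; bounding \<open>exp (- x)\<close> by
  \<open>1 / x\<close>, the failure probabilities sum to at most 1/48. The offset 3 makes this sum
  and the relative error 1/16 small.\<close>

lemma bernoulli_positive_measure_computes:
  obtains G where "G \<in> sets borel" "measure (bernoulli_measure (bias Z)) G > 0"
    "\<And>X. X \<in> G \<Longrightarrow> Z \<le>\<^sub>T X"
proof -
  let ?M = "bernoulli_measure (bias Z)"
  interpret prob_space ?M by (rule prob_space_bernoulli_measure)
  have p: "bias Z \<in> {0..1}" using bias_bounds[of Z] by auto
  define E where "E n = {X :: cantor. (16::real) ^ (n + 3)
    \<le> \<bar>(\<Sum>i<2 ^ (6 * n + 18). of_bool (X i)) - 2 ^ (6 * n + 18) * bias Z\<bar>}" for n :: nat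
  have E_sets: "E n \<in> sets ?M" for n
  proof -
    have "open {X :: cantor. X i}" for i
      using open_prefix[of "Suc i" "{c. bit c i}"] by (simp add: bit_prefix_code)
    then have "{X :: cantor. X i} \<in> sets borel" for i by (rule borel_open)
    then have [measurable]: "Measurable.pred borel (\<lambda>X :: cantor. X i)" for i
      by (simp add: pred_def)
    show ?thesis unfolding sets_bernoulli_measure E_def by measurable
  qed
  have E_le: "prob (E n) \<le> (1 / 64) * (1 / 4) ^ n" for n
  proof -
    have N: "(2::real) ^ (6 * n + 18) = 64 ^ (n + 3)"
    proof -
      have "(64::real) ^ (n + 3) = (2 ^ 6) ^ (n + 3)" by simp
      also have "\<dots> = 2 ^ (6 * (n + 3))" by (simp only: power_mult[symmetric])
      also have "6 * (n + 3) = 6 * n + 18" by simp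
      finally show ?thesis by simp
    qed
    have "((16::real) ^ (n + 3))\<^sup>2 = 64 ^ (n + 3) * 4 ^ (n + 3)"
      by (simp only: power2_eq_square power_mult_distrib[symmetric]) simp
    then have quot: "((16::real) ^ (n + 3))\<^sup>2 / 2 ^ (6 * n + 18) = 4 ^ (n + 3)" by (simp add: N)
    have "prob (E n) \<le> 2 * exp (- 2 * ((16::real) ^ (n + 3))\<^sup>2 / real (2 ^ (6 * n + 18)))"
      unfolding E_def
      using prob_bernoulli_sum_deviation[OF p, of "2 ^ (6 * n + 18)" "16 ^ (n + 3)"] by simp
    also have "- 2 * ((16::real) ^ (n + 3))\<^sup>2 / real (2 ^ (6 * n + 18)) = - (2 * 4 ^ (n + 3))"
      using quot by (simp add: field_simps)
    also have "2 * exp (- (2 * 4 ^ (n + 3))) \<le> 2 * (1 / (2 * (4::real) ^ (n + 3)))"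
    proof -
      have "2 * 4 ^ (n + 3) \<le> exp (2 * 4 ^ (n + 3) :: real)"
        using exp_ge_add_one_self[of "2 * 4 ^ (n + 3) :: real"] by linarith
      then have "1 / exp (2 * 4 ^ (n + 3) :: real) \<le> 1 / (2 * 4 ^ (n + 3))"
        by (intro divide_left_mono) auto
      then show ?thesis by (simp add: exp_minus field_simps)
    qed
    also have "\<dots> = (1 / 64) * (1 / 4) ^ n" by (simp add: power_add power_divide)
    finally show ?thesis .
  qed
  have geo: "(\<lambda>n. (1 / 64) * (1 / 4) ^ n :: real) sums ((1 / 64) * (1 / (1 - 1 / 4)))"
    by (intro sums_mult geometric_sums) simp
  have summ: "summable (\<lambda>n. prob (E n))"
    by (rule summable_comparison_test'[OF sums_summable[OF geo]]) (use E_le in auto)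
  have "prob (\<Union>n. E n) \<le> (\<Sum>n. prob (E n))"
    using E_sets summ by (intro finite_measure_subadditive_countably) auto
  also have "\<dots> \<le> (\<Sum>n. (1 / 64) * (1 / 4) ^ n)"
    using E_le by (intro suminf_le summ sums_summable[OF geo]) auto
  also have "\<dots> = (1 / 64) * (1 / (1 - 1 / 4))" using geo by (simp only: sums_iff)
  finally have "prob (\<Union>n. E n) < 1" by simp
  moreover have "prob (UNIV - (\<Union>n. E n)) = 1 - prob (\<Union>n. E n)"
    using E_sets by (subst prob_compl[symmetric]) auto
  ultimately have "prob (UNIV - (\<Union>n. E n)) > 0" by simp
  moreover have "UNIV - (\<Union>n. E n) \<in> sets borel"
    using E_sets unfolding sets_bernoulli_measure by (intro sets.Diff sets.countable_UN) auto
  moreover have "Z \<le>\<^sub>T X" if "X \<in> UNIV - (\<Union>n. E n)" for X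
    using that by (intro turing_reducible_from_sample) (auto simp: E_def not_le)
  ultimately show thesis by (intro that)
qed


section \<open>Majority vote\<close>

instance recf :: countable by countable_datatype

lemma open_rec_eval: "open {X. rec_eval X f xs v}"
  unfolding open_cantor_iff
proof
  fix X assume "X \<in> {X. rec_eval X f xs v}"
  then obtain s where s: "eval_upto f s X xs = Suc v"
    using eval_upto_complete[of X f xs v] eventually_happens'[OF sequentially_bot] by blast
  have "rec_eval Y f xs v" if "prefix_code s Y = prefix_code s X" for Y
    using that s eval_upto_cong[of s Y X f xs] eval_upto_sound
    by (simp add: prefix_code_eq_prefix_code_iff)
  then show "\<exists>t. \<forall>Y. prefix_code t Y = prefix_code t X \<longrightarrow> Y \<in> {X. rec_eval X f xs v}" by blast
qed

text \<open>\<open>U\<close> is the increasing union of the clopen sets of points whose cylinder of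
  length \<open>t\<close> lies inside \<open>U\<close>.\<close>

lemma open_prefix_approximation:
  assumes "open U" "e > 0"
  obtains t V where "{X. prefix_code t X \<in> V} \<subseteq> U"
    "measure (bernoulli_measure p) (U - {X. prefix_code t X \<in> V}) < e"
proof -
  interpret prob_space "bernoulli_measure p" by (rule prob_space_bernoulli_measure)
  define C where "C t = {X. \<forall>Y. prefix_code t Y = prefix_code t X \<longrightarrow> Y \<in> U}" for t
  have C: "C t = {X. prefix_code t X \<in> prefix_code t ` C t}" for t
    by (auto simp: C_def)
  have "open (C t)" for t using C open_prefix by metis
  then have sets: "C t \<in> events" for t by (auto simp: sets_bernoulli_measure)
  have sub: "C t \<subseteq> U" for t by (auto simp: C_def)
  have "incseq C"
    unfolding incseq_def C_def by (auto simp: prefix_code_eq_prefix_code_iff)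
  then have "(\<lambda>t. prob (C t)) \<longlonglongrightarrow> prob (\<Union>t. C t)"
    using sets by (intro finite_Lim_measure_incseq) auto
  also have "(\<Union>t. C t) = U"
    using assms(1) unfolding open_cantor_iff C_def by blast
  finally have "\<forall>\<^sub>F t in sequentially. prob U - e < prob (C t)"
    using assms(2) by (intro order_tendstoD(1)) auto
  then obtain t where "prob U - e < prob (C t)"
    using eventually_happens'[OF sequentially_bot] by blast
  moreover have "prob (U - C t) = prob U - prob (C t)"
    using sets assms(1) sub by (intro finite_measure_Diff) (auto simp: sets_bernoulli_measure)
  ultimately have "prob (U - C t) < e" by simp
  then show thesis using that[of t "prefix_code t ` C t"] sub C by simp
qed

text \<open>A finite intersection exceeds the full one by less than \<open>e\<close>, and a clopen
  subset exhausts that finite intersection up to less than \<open>e\<close>. Each of the two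
  differences is contained in one of these errors.\<close>

lemma open_INT_prefix_approximation:
  fixes G :: "nat \<Rightarrow> cantor set"
  assumes G: "\<And>n. open (G n)" and e: "e > 0"
  obtains t V where
    "measure (bernoulli_measure p) ({X. prefix_code t X \<in> V} - (\<Inter>n. G n)) < e"
    "measure (bernoulli_measure p) ((\<Inter>n. G n) - {X. prefix_code t X \<in> V}) < e"
proof -
  interpret prob_space "bernoulli_measure p" by (rule prob_space_bernoulli_measure)
  define R where "R = (\<Inter>n. G n)"
  define U where "U n = (\<Inter>k\<in>{..n}. G k)" for n
  have U: "open (U n)" for n unfolding U_def using G by (intro open_INT) auto
  have ev: "G n \<in> events" "U n \<in> events" for n
    using U G by (auto simp: sets_bernoulli_measure)
  then have R: "R \<in> events" unfolding R_def by (intro sets.countable_INT'') (auto simp: sets_bernoulli_measure)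
  have "decseq U" unfolding decseq_def U_def by auto
  then have "(\<lambda>n. prob (U n)) \<longlonglongrightarrow> prob (\<Inter>n. U n)"
    using ev by (intro finite_Lim_measure_decseq) auto
  also have "(\<Inter>n. U n) = R" unfolding U_def R_def by auto
  finally have "\<forall>\<^sub>F n in sequentially. prob (U n) < prob R + e"
    using e by (intro order_tendstoD(2)) auto
  then obtain n where n: "prob (U n) < prob R + e"
    using eventually_happens'[OF sequentially_bot] by blast
  have RU: "R \<subseteq> U n" unfolding R_def U_def by auto
  have "prob (U n - R) = prob (U n) - prob R"
    using ev R RU by (intro finite_measure_Diff) auto
  with n have UR: "prob (U n - R) < e" by simp
  obtain t V where tV: "{X. prefix_code t X \<in> V} \<subseteq> U n"
    "prob (U n - {X. prefix_code t X \<in> V}) < e"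
    using open_prefix_approximation[OF U e] by blast
  have cyl: "{X. prefix_code t X \<in> V} \<in> events"
    using open_prefix by (simp add: sets_bernoulli_measure)
  have "prob ({X. prefix_code t X \<in> V} - R) \<le> prob (U n - R)"
    using tV(1) ev R by (intro finite_measure_mono) auto
  moreover have "prob (R - {X. prefix_code t X \<in> V}) \<le> prob (U n - {X. prefix_code t X \<in> V})"
    using RU ev cyl by (intro finite_measure_mono) auto
  ultimately show thesis using that[of t V] UR tV(2) unfolding R_def by simp
qed

section \<open>Cylinder weights computable from the coded sequence\<close>

lemma Suc_bias_numerator_le: "Suc (bias_numerator Z k) \<le> 4 ^ k"
  by (induction k) (auto simp: of_bool_def)

lemma string_weight_divide:
  fixes a b d :: real
  shows "string_weight (a / d) (b / d) t c = string_weight a b t c / d ^ t"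
proof -
  have "string_weight (a / d) (b / d) t c = (\<Prod>i<t. (if bit c i then a else b) / d)"
    unfolding string_weight_def by (intro prod.cong) auto
  then show ?thesis by (simp add: string_weight_def prod_dividef)
qed

lemma of_nat_string_weight:
  "(of_nat (string_weight a b t c) :: 'a::comm_semiring_1) = string_weight (of_nat a) (of_nat b) t c"
  unfolding string_weight_def of_nat_prod by (intro prod.cong) auto

text \<open>Divided by \<open>(4^t)^t\<close> this is a lower bound for the measure of the cylinder coded by \<open>c\<close>. The total
  defect over all strings of length \<open>t\<close> is at most \<open>t / 4^t\<close>.\<close>

definition approx_weight :: "cantor \<Rightarrow> nat \<Rightarrow> nat \<Rightarrow> nat" where
  "approx_weight Z t c = string_weight (bias_numerator Z t) (4 ^ t - 1 - bias_numerator Z t) t c"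

text \<open>Rounding \<open>p\<close> and \<open>1 - p\<close> down to multiples of
  \<open>1 / 4 ^ t\<close> lowers every weight, and the total weight drops from 1 to
  \<open>(1 - 1 / 4 ^ t) ^ t\<close>. Bernoulli's inequality bounds the total loss by
  \<open>t / 4 ^ t\<close>, and the loss over \<open>C\<close> is a part of it.\<close>

lemma approx_weight_bounds:
  fixes C :: "nat set" and Z :: cantor
  assumes C: "C \<subseteq> {..<2 ^ t}"
  defines "m \<equiv> measure (bernoulli_measure (bias Z)) {X. prefix_code t X \<in> C}"
    and "s \<equiv> real (\<Sum>c\<in>C. approx_weight Z t c) / (4 ^ t) ^ t"
  shows "s \<le> m" "m \<le> s + t / 4 ^ t"
proof -
  define p where "p = bias Z"
  define a b :: real where "a = bias_numerator Z t" and "b = (4 ^ t - 1 - bias_numerator Z t :: nat)"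
  \<comment> \<open>The numerator is at most \<open>4 ^ t - 1\<close>, so the subtraction on
    naturals is exact.\<close>
  have b: "b = 4 ^ t - 1 - a"
    using Suc_bias_numerator_le[of Z t] unfolding a_def b_def by (simp add: of_nat_diff)
  have p: "p \<in> {0..1}" using bias_bounds[of Z] by (auto simp: p_def)
  define w l where "w = string_weight p (1 - p) t"
    and "l = string_weight (a / 4 ^ t) (b / 4 ^ t) t"
  have s: "s = (\<Sum>c\<in>C. l c)"
    unfolding s_def l_def approx_weight_def string_weight_divide a_def b_def of_nat_sum
      of_nat_string_weight sum_divide_distrib ..
  have m: "m = (\<Sum>c\<in>C. w c)"
    using C unfolding m_def w_def p_def[symmetric] measure_prefix_code_in[OF p] by (simp add: Int_absorb1)
  have "a / 4 ^ t \<le> p" "b / 4 ^ t \<le> 1 - p"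
    using bias_numerator_bounds[of t Z] unfolding b unfolding a_def p_def
    by (simp_all add: field_simps)
  moreover have "0 \<le> a" "0 \<le> b" by (simp_all add: a_def b_def)
  ultimately have le: "l c \<le> w c" for c
    unfolding l_def w_def string_weight_def by (intro prod_mono) auto
  then show "s \<le> m" unfolding s m by (rule sum_mono)
  have "m - s = (\<Sum>c\<in>C. w c - l c)" unfolding s m by (simp add: sum_subtractf)
  also have "\<dots> \<le> (\<Sum>c<2 ^ t. w c - l c)"
    using C le by (intro sum_mono2) auto
  also have "\<dots> = 1 - (a / 4 ^ t + b / 4 ^ t) ^ t"
    unfolding sum_subtractf w_def l_def sum_string_weight by simp
  also have "a / 4 ^ t + b / 4 ^ t = 1 + (- 1 / 4 ^ t)" by (simp add: b field_simps)
  also have "1 - (1 + (- 1 / 4 ^ t)) ^ t \<le> real t / 4 ^ t"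
    using Bernoulli_inequality[of "- 1 / 4 ^ t" t] by (simp add: field_simps)
  finally show "m \<le> s + t / 4 ^ t" by simp
qed

lemma computable_in_bias_numerator:
  assumes "computable_in Z k F"
  shows "computable_in Z k (\<lambda>xs. bias_numerator Z (F xs))"
proof -
  have "computable_in Z k (\<lambda>xs. rec_nat 0
      (\<lambda>n r. 4 * (n # r # xs) ! 1 + 1 + of_bool (Z ((n # r # xs) ! 0))) (F xs))"
    by (intro computable_in_rec_nat computable_in_intros assms) simp_all
  then show ?thesis
  proof (rule computable_in_cong)
    fix xs
    have "rec_nat 0 (\<lambda>n r. 4 * (n # r # xs) ! 1 + 1 + of_bool (Z ((n # r # xs) ! 0))) m
      = bias_numerator Z m" for m
      by (induction m) auto
    then show "rec_nat 0 (\<lambda>n r. 4 * (n # r # xs) ! 1 + 1 + of_bool (Z ((n # r # xs) ! 0))) (F xs)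
      = bias_numerator Z (F xs)" by blast
  qed
qed

text \<open>If \<open>c\<close> codes a string of length at least \<open>s\<close>, then \<open>c mod 2^s\<close> codes its prefix of length \<open>s\<close>.\<close>

definition vote :: "recf \<Rightarrow> nat set \<Rightarrow> nat \<Rightarrow> nat \<Rightarrow> nat \<Rightarrow> nat \<Rightarrow> nat set" where
  "vote f V s t n v = {c. c < 2 ^ t \<and> c mod 2 ^ s \<in> V \<and> eval_upto f t (bit c) [n] = Suc v}"

text \<open>\<open>f\<close>, \<open>V\<close>, \<open>s\<close> and \<open>v\<close> are built into
  the program; the inputs are a stage and \<open>n\<close>. Writing the length as
  \<open>xs ! 0 + s\<close> guarantees that every string has a prefix of length
  \<open>s\<close>.\<close>

lemma computable_in_vote_weight:
  assumes "finite V"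
  shows "computable_in Z 2 (\<lambda>xs. \<Sum>c\<in>vote f V s (xs ! 0 + s) (xs ! 1) v. approx_weight Z (xs ! 0 + s) c)"
proof -
  have E: "computable_in Z 3 (\<lambda>ys. eval_upto f (ys ! 1 + s) (bit (ys ! 0)) (map (\<lambda>G. G ys) [\<lambda>ys. ys ! 2]))"
    by (rule computable_in_eval_upto_compose[OF computable_in_eval_upto])
      (auto intro!: computable_in_add computable_in_nth computable_in_const)
  have P: "computable_in Z 3 (\<lambda>ys. \<Prod>i<ys ! 1 + s.
      (\<lambda>zs. if bit (zs ! 1) (zs ! 0) then bias_numerator Z (zs ! 2 + s)
        else 4 ^ (zs ! 2 + s) - 1 - bias_numerator Z (zs ! 2 + s)) (i # ys))"
    by (intro computable_in_prod computable_in_intros computable_in_bias_numerator) simp_all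
  \<comment> \<open>The list \<open>ys\<close> is string code, stage, \<open>n\<close>, and
    \<open>zs\<close> has a position in front of it. The remainder modulo \<open>2 ^ s\<close> is
    expressed by division and subtraction.\<close>
  have "computable_in Z 2 (\<lambda>xs. \<Sum>c<2 ^ (xs ! 0 + s).
      (\<lambda>ys. if ys ! 0 - 2 ^ s * (ys ! 0 div 2 ^ s) \<in> V \<and>
          eval_upto f (ys ! 1 + s) (bit (ys ! 0)) (map (\<lambda>G. G ys) [\<lambda>ys. ys ! 2]) = Suc v
        then (\<Prod>i<ys ! 1 + s.
          (\<lambda>zs. if bit (zs ! 1) (zs ! 0) then bias_numerator Z (zs ! 2 + s)
            else 4 ^ (zs ! 2 + s) - 1 - bias_numerator Z (zs ! 2 + s)) (i # ys)) else 0) (c # xs))"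
  proof (rule computable_in_sum)
    show "computable_in Z (Suc 2) (\<lambda>ys. if ys ! 0 - 2 ^ s * (ys ! 0 div 2 ^ s) \<in> V \<and>
          eval_upto f (ys ! 1 + s) (bit (ys ! 0)) (map (\<lambda>G. G ys) [\<lambda>ys. ys ! 2]) = Suc v
        then (\<Prod>i<ys ! 1 + s.
          (\<lambda>zs. if bit (zs ! 1) (zs ! 0) then bias_numerator Z (zs ! 2 + s)
            else 4 ^ (zs ! 2 + s) - 1 - bias_numerator Z (zs ! 2 + s)) (i # ys)) else 0)"
      using E P
      by (intro computable_in_if decidable_in_conj decidable_in_finite[OF assms] decidable_in_eq
          computable_in_intros) simp_all
    show "computable_in Z 2 (\<lambda>xs. 2 ^ (xs ! 0 + s))" by (intro computable_in_intros) simp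
  qed
  then show ?thesis
  proof (rule computable_in_cong)
    fix xs :: "nat list" assume "length xs = 2"
    then obtain t n where xs: "xs = [t, n]" by (auto simp: numeral_2_eq_2 length_Suc_conv)
    have "(\<Sum>c\<in>vote f V s (t + s) n v. approx_weight Z (t + s) c)
      = (\<Sum>c<2 ^ (t + s). if c mod 2 ^ s \<in> V \<and> eval_upto f (t + s) (bit c) [n] = Suc v
          then approx_weight Z (t + s) c else 0)"
      by (subst sum.inter_filter[symmetric]) (auto intro!: sum.cong simp: vote_def)
    then show "(\<Sum>c<2 ^ (xs ! 0 + s).
      (\<lambda>ys. if ys ! 0 - 2 ^ s * (ys ! 0 div 2 ^ s) \<in> V \<and>
          eval_upto f (ys ! 1 + s) (bit (ys ! 0)) (map (\<lambda>G. G ys) [\<lambda>ys. ys ! 2]) = Suc v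
        then (\<Prod>i<ys ! 1 + s.
          (\<lambda>zs. if bit (zs ! 1) (zs ! 0) then bias_numerator Z (zs ! 2 + s)
            else 4 ^ (zs ! 2 + s) - 1 - bias_numerator Z (zs ! 2 + s)) (i # ys)) else 0) (c # xs))
      = (\<Sum>c\<in>vote f V s (xs ! 0 + s) (xs ! 1) v. approx_weight Z (xs ! 0 + s) c)"
      by (simp add: xs approx_weight_def string_weight_def minus_mult_div_eq_mod cong: if_cong)
  qed
qed

lemma prefix_code_in_vote_iff:
  assumes "s \<le> t"
  shows "prefix_code t X \<in> vote f V s t n v \<longleftrightarrow> prefix_code s X \<in> V \<and> eval_upto f t X [n] = Suc v"
proof -
  have "eval_upto f t (bit (prefix_code t X)) [n] = eval_upto f t X [n]"
    by (rule eval_upto_cong) (simp add: bit_prefix_code)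
  then show ?thesis using assms by (simp add: vote_def prefix_code_mod prefix_code_less)
qed

text \<open>A clopen set \<open>C\<close> approximates the set \<open>R\<close> of oracles from which \<open>f\<close> computes \<open>W\<close> so well that inside
  \<open>C\<close> wrong votes have measure below the threshold \<open>r\<close> and right votes eventually exceed it.\<close>

lemma turing_reducible_of_uniform_positive_measure:
  assumes pos: "measure (bernoulli_measure (bias Z)) {X. \<forall>n. rec_eval X f [n] (of_bool (W n))} > 0"
  shows "W \<le>\<^sub>T Z"
proof -
  let ?M = "bernoulli_measure (bias Z)"
  interpret prob_space ?M by (rule prob_space_bernoulli_measure)
  define R where "R = {X. \<forall>n. rec_eval X f [n] (of_bool (W n))}"
  define \<delta> where "\<delta> = prob R"
  have \<delta>: "\<delta> > 0" using pos by (simp add: \<delta>_def R_def)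
  have R_INT: "R = (\<Inter>n. {X. rec_eval X f [n] (of_bool (W n))})" unfolding R_def by blast
  have R: "R \<in> events"
    unfolding R_INT sets_bernoulli_measure
    by (intro sets.countable_INT'') (auto intro: borel_open open_rec_eval)
  obtain s V0 where V0:
    "prob ({X. prefix_code s X \<in> V0} - R) < \<delta> / 4" "prob (R - {X. prefix_code s X \<in> V0}) < \<delta> / 4"
    unfolding R_INT
    by (rule open_INT_prefix_approximation[where G = "\<lambda>n. {X. rec_eval X f [n] (of_bool (W n))}"
        and e = "\<delta> / 4" and p = "bias Z"]) (use \<delta> open_rec_eval in \<open>simp_all split del: split_of_bool\<close>)
  \<comment> \<open>Cutting down to actual codes makes \<open>V\<close> finite, hence decidable,
    without changing the clopen set.\<close>
  define V where "V = V0 \<inter> {..<2 ^ s}"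
  define C where "C = {X. prefix_code s X \<in> V}"
  have "C = {X. prefix_code s X \<in> V0}"
    using prefix_code_less by (auto simp: C_def V_def)
  with V0 have CR: "prob (C - R) < \<delta> / 4" and RC: "prob (R - C) < \<delta> / 4" by simp_all
  have C: "C \<in> events" unfolding C_def using open_prefix by (simp add: sets_bernoulli_measure)
  have "prob R = prob (C \<inter> R) + prob (R - C)"
    using C R by (subst finite_measure_Diff') (auto simp: Int_commute)
  with RC have CR_big: "prob (C \<inter> R) > 3 / 4 * \<delta>" by (simp add: \<delta>_def)
  \<comment> \<open>Wrong votes weigh less than \<open>\<delta> / 4\<close>, and right votes will
    exceed \<open>\<delta> / 2\<close>. A rational \<open>r\<close> in between turns the test into a
    comparison of naturals.\<close>
  obtain r where r: "r \<in> \<rat>" "\<delta> / 4 < r" "r < \<delta> / 2"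
    using Rats_dense_in_real[of "\<delta> / 4" "\<delta> / 2"] \<delta> by auto
  obtain num den :: nat where nd: "den \<noteq> 0" "r = num / den"
  proof (rule Rats_abs_nat_div_natE[OF r(1)])
    fix m n :: nat assume "n \<noteq> 0" "\<bar>r\<bar> = m / n"
    moreover have "\<bar>r\<bar> = r" using r(2) \<delta> by simp
    ultimately show thesis using that by metis
  qed
  define total where "total t n v = (\<Sum>c\<in>vote f V s t n v. approx_weight Z t c)" for t n v
  define Q where "Q t n v \<longleftrightarrow> num * (4 ^ t) ^ t < total t n v * den" for t n v
  have Q_iff: "Q t n v \<longleftrightarrow> r < real (total t n v) / (4 ^ t) ^ t" for t n v
  proof -
    have "Q t n v \<longleftrightarrow> real (num * (4 ^ t) ^ t) < real (total t n v * den)"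
      unfolding Q_def of_nat_less_iff ..
    then show ?thesis unfolding nd(2) using nd(1) by (simp add: field_simps)
  qed
  have vote_sub: "vote f V s t n v \<subseteq> {..<2 ^ t}" for t n v by (auto simp: vote_def)
  have sound: "v = of_bool (W n)" if t: "s \<le> t" and Q: "Q t n v" for t n v
  proof (rule ccontr)
    assume v: "v \<noteq> of_bool (W n)"
    \<comment> \<open>A voter for a wrong value has a convergent computation with that value, so by
      determinism it lies outside \<open>R\<close>.\<close>
    have "{X. prefix_code t X \<in> vote f V s t n v} \<subseteq> C - R"
      using v eval_upto_sound rec_eval_deterministic
      unfolding prefix_code_in_vote_iff[OF t] C_def R_def by blast
    then have "prob {X. prefix_code t X \<in> vote f V s t n v} \<le> prob (C - R)"
      using C R by (intro finite_measure_mono) auto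
    with approx_weight_bounds(1)[OF vote_sub[of t n v], of Z] CR r(2)
    have "real (total t n v) / (4 ^ t) ^ t < r" unfolding total_def by linarith
    with Q show False unfolding Q_iff by simp
  qed
  have complete: "\<exists>t\<ge>s. Q t n (of_bool (W n))" for n
  proof -
    define v :: nat where "v = of_bool (W n)"
    \<comment> \<open>Demanding the right answer at all later stages makes the sets increase, and
      completeness of the evaluation makes \<open>C \<inter> R\<close> their union.\<close>
    define D where "D t = {X\<in>C \<inter> R. \<forall>u\<ge>t. eval_upto f u X [n] = Suc v}" for t
    have "eval_upto f u (bit (prefix_code u X)) [n] = eval_upto f u X [n]" for u X
      by (rule eval_upto_cong) (simp add: bit_prefix_code)
    then have op: "open {X. eval_upto f u X [n] = Suc v}" for u
      using open_prefix[of u "{c. eval_upto f u (bit c) [n] = Suc v}"] by simp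
    have D: "D t \<in> events" for t
    proof -
      have "(\<Inter>u\<in>{t..}. {X. eval_upto f u X [n] = Suc v}) \<in> events"
        unfolding sets_bernoulli_measure using borel_open[OF op] by (intro sets.countable_INT') auto
      moreover have "D t = C \<inter> R \<inter> (\<Inter>u\<in>{t..}. {X. eval_upto f u X [n] = Suc v})"
        by (auto simp: D_def)
      ultimately show ?thesis using C R by auto
    qed
    have "incseq D" by (auto simp: incseq_def D_def)
    then have "(\<lambda>t. prob (D t)) \<longlonglongrightarrow> prob (\<Union>t. D t)"
      using D by (intro finite_Lim_measure_incseq) auto
    also have "(\<Union>t. D t) = C \<inter> R"
      using eval_upto_complete[of _ f "[n]" v] unfolding eventually_sequentially
      by (fastforce simp: D_def R_def v_def)
    \<comment> \<open>5/8 lies below 3/4 and still leaves 1/2 after the rounding loss of less than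
      \<open>\<delta> / 8\<close>.\<close>
    finally have "\<forall>\<^sub>F t in sequentially. 5 / 8 * \<delta> < prob (D t)"
      using CR_big \<delta> by (intro order_tendstoD(1)) auto
    moreover have "(\<lambda>t. real t / 4 ^ t) \<longlonglongrightarrow> 0"
    proof -
      have "(\<lambda>t. real t * (1 / 4) ^ t) \<longlonglongrightarrow> 0"
        using powser_times_n_limit_0[of "1 / 4 :: real"] by simp
      then show ?thesis by (simp add: power_divide)
    qed
    then have "\<forall>\<^sub>F t in sequentially. real t / 4 ^ t < \<delta> / 8"
      using \<delta> by (intro order_tendstoD(2)) auto
    ultimately have "\<forall>\<^sub>F t in sequentially. Q t n v \<and> s \<le> t"
      using eventually_ge_at_top[of s]
    proof eventually_elim
      case (elim t)
      have "D t \<subseteq> {X. prefix_code t X \<in> vote f V s t n v}"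
        unfolding prefix_code_in_vote_iff[OF elim(3)] by (auto simp: D_def C_def)
      then have "prob (D t) \<le> prob {X. prefix_code t X \<in> vote f V s t n v}"
        using open_prefix by (intro finite_measure_mono) (auto simp: sets_bernoulli_measure)
      with approx_weight_bounds(2)[OF vote_sub[of t n v], of Z] elim(1,2) r(3)
      have "r < real (total t n v) / (4 ^ t) ^ t" unfolding total_def by linarith
      then show ?case using elim(3) by (simp add: Q_iff)
    qed
    then show ?thesis
      using eventually_happens'[OF sequentially_bot] unfolding v_def by blast
  qed
  have dec: "decidable_in Z 2 (\<lambda>xs. Q (xs ! 0 + s) (xs ! 1) v)" for v
    unfolding Q_def total_def
    by (intro decidable_in_less computable_in_mult computable_in_vote_weight computable_in_power
        computable_in_add computable_in_const computable_in_nth) (simp_all add: V_def)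
  \<comment> \<open>The first stage at which some value wins. Since only the right value can win
    there, testing whether 1 wins answers the question.\<close>
  define L where "L n = (LEAST t. (of_bool (\<not> (Q (t + s) n 0 \<or> Q (t + s) n 1)) :: nat) = 0)" for n
  have ex: "\<exists>t. (of_bool (\<not> (Q (t + s) n 0 \<or> Q (t + s) n 1)) :: nat) = 0" for n
  proof -
    obtain t where "s \<le> t" "Q t n (of_bool (W n))" using complete by blast
    then have "Q (t - s + s) n 0 \<or> Q (t - s + s) n 1" by (cases "W n") auto
    then show ?thesis by (intro exI[of _ "t - s"]) simp
  qed
  have "computable_in Z 1 (\<lambda>xs. LEAST t. (\<lambda>ys. of_bool (\<not> (Q (ys ! 0 + s) (ys ! 1) 0
      \<or> Q (ys ! 0 + s) (ys ! 1) 1)) :: nat) (t # xs) = 0)"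
    using dec ex
    by (intro computable_in_Least decidable_in_not decidable_in_disj) (simp_all add: numeral_2_eq_2)
  then have L: "computable_in Z 1 (\<lambda>xs. L (xs ! 0))" by (simp add: L_def)
  have "decidable_in Z 1 (\<lambda>xs. (\<lambda>xs. Q (xs ! 0 + s) (xs ! 1) 1) (map (\<lambda>G. G xs) [\<lambda>xs. L (xs ! 0), \<lambda>xs. xs ! 0]))"
    by (rule computable_in_compose[OF dec]) (use L in \<open>auto intro: computable_in_nth\<close>)
  moreover have "Q (L n + s) n 1 \<longleftrightarrow> W n" for n
  proof -
    have "(of_bool (\<not> (Q (L n + s) n 0 \<or> Q (L n + s) n 1)) :: nat) = 0"
      unfolding L_def using ex by (rule LeastI_ex)
    then have "Q (L n + s) n 0 \<or> Q (L n + s) n 1" by simp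
    then show ?thesis using sound[of "L n + s" n 0] sound[of "L n + s" n 1] by (cases "W n") auto
  qed
  ultimately show ?thesis by (intro turing_reducibleI) simp
qed

text \<open>There are countably many programs; if each succeeded only on a null set,
  \<open>S\<close> would be null.\<close>

lemma turing_reducible_of_positive_measure:
  assumes S: "S \<in> sets borel" "measure (bernoulli_measure (bias Z)) S > 0"
    and W: "\<And>X. X \<in> S \<Longrightarrow> W \<le>\<^sub>T X"
  shows "W \<le>\<^sub>T Z"
proof -
  let ?M = "bernoulli_measure (bias Z)"
  interpret prob_space ?M by (rule prob_space_bernoulli_measure)
  define R where "R f = {X. \<forall>n. rec_eval X f [n] (of_bool (W n))}" for f
  have "R f = (\<Inter>n. {X. rec_eval X f [n] (of_bool (W n))})" for f unfolding R_def by blast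
  then have R: "R f \<in> events" for f
    unfolding sets_bernoulli_measure
    by (simp only:) (intro sets.countable_INT'', auto intro: borel_open open_rec_eval)
  have "\<exists>f. prob (R f) > 0"
  proof (rule ccontr)
    assume "\<not> ?thesis"
    then have "prob (R f) = 0" for f by (metis measure_nonneg order_le_less)
    then have "R f \<in> null_sets ?M" for f using R by (auto simp: null_sets_def emeasure_eq_measure)
    then have "(\<Union>f. R f) \<in> null_sets ?M" by (rule null_sets_UN)
    moreover have "S \<subseteq> (\<Union>f. R f)"
      using W unfolding turing_reducible_def R_def by blast
    ultimately have "S \<in> null_sets ?M"
      using S(1) by (auto intro: null_sets_subset simp: sets_bernoulli_measure)
    then show False using S(2) by (simp add: null_sets_def emeasure_eq_measure)
  qed
  then show ?thesis unfolding R_def using turing_reducible_of_uniform_positive_measure by blast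
qed


section \<open>The induced automorphism\<close>

lemma bernoulli_preserving_inverse:
  assumes "\<And>X. \<psi> (\<phi> X) = X" "continuous_on UNIV \<psi>" "bernoulli_preserving p \<phi>"
  shows "bernoulli_preserving p \<psi>"
  unfolding bernoulli_preserving_def
proof
  fix U :: "cantor set" assume "U \<in> sets borel"
  then have "\<psi> -` U \<in> sets borel"
    using borel_measurable_continuous_onI[OF assms(2)] by (metis measurable_sets_borel)
  moreover have "\<phi> -` \<psi> -` U = U" using assms(1) by auto
  ultimately show "emeasure (bernoulli_measure p) (\<psi> -` U) = emeasure (bernoulli_measure p) U"
    using assms(3) unfolding bernoulli_preserving_def by metis
qed

text \<open>If \<open>\<psi> X\<close> lies in \<open>G\<close>, then \<open>Z\<close> reduces to
  \<open>\<psi> X\<close>, and applying \<open>\<phi>\<close> shows that \<open>\<phi> Z\<close>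
  reduces to \<open>X\<close>. Such \<open>X\<close> form the preimage of \<open>G\<close> under
  \<open>\<psi>\<close>, so preservation is asked of \<open>\<psi>\<close>. Both directions of the
  homeomorphism can take the role of \<open>\<phi>\<close>.\<close>

lemma turing_reducible_image:
  assumes inv: "\<And>X. \<phi> (\<psi> X) = X" and cont: "continuous_on UNIV \<psi>"
    and pres: "\<And>p. p \<in> {0..1} \<Longrightarrow> bernoulli_preserving p \<psi>"
    and mono: "\<And>X Y. X \<le>\<^sub>T Y \<Longrightarrow> \<phi> X \<le>\<^sub>T \<phi> Y"
  shows "\<phi> Z \<le>\<^sub>T Z"
proof -
  let ?M = "bernoulli_measure (bias Z)"
  obtain G where G: "G \<in> sets borel" "measure ?M G > 0" "\<And>X. X \<in> G \<Longrightarrow> Z \<le>\<^sub>T X"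
    using bernoulli_positive_measure_computes[of Z] by blast
  show ?thesis
  proof (rule turing_reducible_of_positive_measure)
    show "\<psi> -` G \<in> sets borel"
      using borel_measurable_continuous_onI[OF cont] G(1) by (metis measurable_sets_borel)
    have "emeasure ?M (\<psi> -` G) = emeasure ?M G"
      using pres[of "bias Z"] bias_bounds[of Z] G(1) by (auto simp: bernoulli_preserving_def)
    then show "measure ?M (\<psi> -` G) > 0" using G(2) by (simp add: measure_def)
    show "\<phi> Z \<le>\<^sub>T X" if "X \<in> \<psi> -` G" for X
      using mono[OF G(3)[of "\<psi> X"]] that by (simp add: inv)
  qed
qed

theorem theorem7p3:
  fixes \<phi> :: "cantor \<Rightarrow> cantor" and \<pi> :: "turing_degree \<Rightarrow> turing_degree"
  assumes "\<exists>\<psi>. homeomorphism UNIV UNIV \<phi> \<psi>"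
    and "(\<forall>p\<in>{0<..<1}. bernoulli_preserving p \<phi>) \<or>
         infinite {p\<in>{0<..<1}. bernoulli_preserving p \<phi>} \<or>
         (\<exists>p\<in>{0<..<1}. \<not> algebraic p \<and> bernoulli_preserving p \<phi>)"
    and "\<forall>X. \<pi> (turing_deg X) = turing_deg (\<phi> X)"
    and "turing_degree_automorphism \<pi>"
  shows "\<pi> = id"
proof -
  obtain \<psi> where "homeomorphism UNIV UNIV \<phi> \<psi>" using assms(1) by blast
  then have inv: "\<And>X. \<psi> (\<phi> X) = X" "\<And>X. \<phi> (\<psi> X) = X"
    and cont: "continuous_on UNIV \<phi>" "continuous_on UNIV \<psi>"
    by (auto simp: homeomorphism_def)
  have "infinite {p\<in>{0<..<1}. bernoulli_preserving p \<phi>} \<or>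
      (\<exists>p\<in>{0<..<1}. \<not> algebraic p \<and> bernoulli_preserving p \<phi>)"
  proof (cases "\<forall>p\<in>{0<..<1}. bernoulli_preserving p \<phi>")
    case True
    then have "{p\<in>{0<..<1}. bernoulli_preserving p \<phi>} = {0<..<1}" by auto
    then show ?thesis by (simp add: infinite_Ioo)
  qed (use assms(2) in blast)
  then have pres: "bernoulli_preserving p \<phi>" if "p \<in> {0..1}" for p
    using bernoulli_preserving_all[OF cont(1) _ that] by blast
  then have pres': "bernoulli_preserving p \<psi>" if "p \<in> {0..1}" for p
    using bernoulli_preserving_inverse[OF inv(1) cont(2)] that by blast
  have \<phi>_iff: "\<phi> X \<le>\<^sub>T \<phi> Y \<longleftrightarrow> X \<le>\<^sub>T Y" for X Y
    using assms(3,4) unfolding turing_degree_automorphism_def by (metis turing_deg_le_iff)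
  have "\<phi> Z \<equiv>\<^sub>T Z" for Z
  proof -
    have "\<phi> Z \<le>\<^sub>T Z"
      using inv(2) cont(2) pres' by (rule turing_reducible_image) (simp_all add: \<phi>_iff)
    \<comment> \<open>The same argument with the roles exchanged; applying \<open>\<phi>\<close>
      then gives the reduction of \<open>Z\<close> to \<open>\<phi> Z\<close>.\<close>
    moreover have "\<psi> Z \<le>\<^sub>T Z"
      using inv(1) cont(1) pres
    proof (rule turing_reducible_image)
      show "\<psi> X \<le>\<^sub>T \<psi> Y" if "X \<le>\<^sub>T Y" for X Y
        using that \<phi>_iff[of "\<psi> X" "\<psi> Y"] by (simp add: inv)
    qed
    then have "Z \<le>\<^sub>T \<phi> Z" using \<phi>_iff[of "\<psi> Z" Z] by (simp add: inv)
    ultimately show ?thesis by (simp add: turing_equiv_def)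
  qed
  then have "\<pi> (turing_deg X) = turing_deg X" for X
    using assms(3) by (simp add: turing_deg_eq_iff)
  then have "\<pi> a = a" for a
    by (metis Quotient_rep_abs_fold_unmap Quotient_abs_rep Quotient_turing_degree)
  then show ?thesis by (simp add: fun_eq_iff)
qed

end
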